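(* For every $n\ge1$, the polynomial $A^{(2)}_{\rm UU}(4n;t,y,z)$ can be expressed as $$A^{(2)}_{\rm UU}(4n;t,y,z)=\det_{0\le i,j\le n-1}\Bigg[\sum_{k=0}^{n-1}\Bigg(\big(t+(1+y)(1+z)\big)\binom{i+j}{i+k}\binom{i+k}{2k}t^k+\Big((1+z)\binom{i+j}{i+k}\binom{i+k}{2k+1}+(1+y)\binom{i+j}{i+k+1}\binom{i+k+1}{2k+1}\Big)t^{k+1}\Bigg)\Bigg].$$
   Context: With $[z]=z-z^{-1}$ and parameters $q,b,c$, the polynomial $A^{(2)}_{\rm UU}(4n;t,y,z)$ is defined by $$A^{(2)}_{\rm UU}(4n;t,y,z)=\frac{[q^2]^{2n}\,Z^{(2)}_{\rm UU}(1,\dots,1;1,\dots,1;b,c)}{[q]^{n(2n+1)}([b/q][c/q])^n},\quad t=\Big(\frac{[q^2]}{[q]}\Big)^2,\ y=\frac{[bq]}{[b/q]},\ z=\frac{[cq]}{[c/q]},$$ where $Z^{(2)}_{\rm UU}(1,\dots,1;1,\dots,1;b,c)$ is the limit $x_i,y_j\to1$ of $$Z^{(2)}_{\rm UU}(\{x_i\};\{y_i\};b,c)=\frac{\prod_{i,j=1}^n[qx_i/y_j][qy_j/x_i][qx_iy_j][q/(x_iy_j)]}{\prod_{1\le i<j\le n}[x_j/x_i][y_i/y_j]\prod_{1\le i\le j\le n}[1/(x_ix_j)][y_iy_j]}\det_{1\le i,j\le n}\Big(\tfrac{[b/y_j][cx_i]}{[qx_i/y_j]}-\tfrac{[b/y_j][c/x_i]}{[q/(x_iy_j)]}+\tfrac{[by_j][c/x_i]}{[qy_j/x_i]}-\tfrac{[by_j][cx_i]}{[qx_iy_j]}\Big).$$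 (This is a factor, due to Kuperberg, of the generating function of $2n\times2n$ alternating sign matrices with double U-turn boundary conditions.) *)

theory Defs
  imports "HOL-Analysis.Function_Topology" "Jordan_Normal_Form.Determinant"
begin

text \<open>\<open>br z\<close> is usually written \<open>[z]\<close>.\<close>

definition br :: "complex \<Rightarrow> complex" where
  "br z = z - inverse z"

text \<open>
  The \<open>n\<close>-tuples of spectral parameters are the restrictions of functions
  \<^typ>\<open>nat \<Rightarrow> complex\<close> to the indices \<open>{0..<n}\<close>
  (rather than \<open>{1..n}\<close>); the values at other indices are irrelevant throughout.
\<close>

definition Z_UU2_denom :: "nat \<Rightarrow> (nat \<Rightarrow> complex) \<Rightarrow> (nat \<Rightarrow> complex) \<Rightarrow> complex" where
  "Z_UU2_denom n x y =
     (\<Prod>j<n. \<Prod>i<j. br (x j / x i) * br (y i / y j)) *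
     (\<Prod>j<n. \<Prod>i\<le>j. br (1 / (x i * x j)) * br (y i * y j))"

definition Z_UU2_entry ::
  "complex \<Rightarrow> complex \<Rightarrow> complex \<Rightarrow> complex \<Rightarrow> complex \<Rightarrow> complex" where
  "Z_UU2_entry q b c x y =
     br (b / y) * br (c * x) / br (q * x / y)
   - br (b / y) * br (c / x) / br (q / (x * y))
   + br (b * y) * br (c / x) / br (q * y / x)
   - br (b * y) * br (c * x) / br (q * x * y)"

definition Z_UU2 ::
  "nat \<Rightarrow> complex \<Rightarrow> complex \<Rightarrow> complex \<Rightarrow> (nat \<Rightarrow> complex) \<Rightarrow> (nat \<Rightarrow> complex) \<Rightarrow> complex" where
  "Z_UU2 n q b c x y =
     (\<Prod>i<n. \<Prod>j<n. br (q * x i / y j) * br (q * y j / x i)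
                    * br (q * x i * y j) * br (q / (x i * y j)))
     / Z_UU2_denom n x y
     * Determinant.det (Matrix.mat n n (\<lambda>(i, j). Z_UU2_entry q b c (x i) (y j)))"

text \<open>The points at which no denominator in the formula for \<open>Z_UU2\<close> vanishes.\<close>

definition Z_UU2_dom :: "nat \<Rightarrow> complex \<Rightarrow> ((nat \<Rightarrow> complex) \<times> (nat \<Rightarrow> complex)) set" where
  "Z_UU2_dom n q = {(x, y).
     (\<forall>i<n. x i \<noteq> 0 \<and> y i \<noteq> 0) \<and>
     Z_UU2_denom n x y \<noteq> 0 \<and>
     (\<forall>i<n. \<forall>j<n. br (q * x i / y j) \<noteq> 0 \<and> br (q / (x i * y j)) \<noteq> 0 \<and>
                     br (q * y j / x i) \<noteq> 0 \<and> br (q * x i * y j) \<noteq> 0)}"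

text \<open>
  \<open>L\<close> is the value \<open>Z(1,\<dots>,1;1,\<dots>,1;b,c)\<close>, i.e. the joint limit of \<open>Z_UU2\<close> as all
  \<open>x\<^sub>i, y\<^sub>j \<rightarrow> 1\<close>. Function spaces carry the product topology, so, as \<open>Z_UU2 n\<close> only depends
  on the first \<open>n\<close> coordinates, this is the limit in \<open>2n\<close> complex variables.
\<close>

definition Z_UU2_limit :: "nat \<Rightarrow> complex \<Rightarrow> complex \<Rightarrow> complex \<Rightarrow> complex \<Rightarrow> bool" where
  "Z_UU2_limit n q b c L \<longleftrightarrow>
     ((\<lambda>(x, y). Z_UU2 n q b c x y) \<longlongrightarrow> L) (at (\<lambda>_. 1, \<lambda>_. 1) within Z_UU2_dom n q)"

text \<open>
  Polynomials in \<open>t, y, z\<close> are represented as elements of \<open>\<complex>[t][y][z]\<close>: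
  the innermost variable is \<open>t\<close>, the outermost one is \<open>z\<close>.
\<close>

type_synonym poly3 = "complex poly poly poly"

definition t_var :: poly3 where "t_var = [:[:[:0, 1:]:]:]"
definition y_var :: poly3 where "y_var = [:[:0, 1:]:]"
definition z_var :: poly3 where "z_var = [:0, 1:]"

definition eval3 :: "poly3 \<Rightarrow> complex \<Rightarrow> complex \<Rightarrow> complex \<Rightarrow> complex" where
  "eval3 P t y z = poly (poly (poly P [:[:z:]:]) [:y:]) t"

text \<open>
  The relation that defines the polynomial, required for all parameters
  for which the denominators \<open>[q], [b/q], [c/q]\<close> do not vanish.
\<close>

definition is_A_UU2 :: "nat \<Rightarrow> poly3 \<Rightarrow> bool" where
  "is_A_UU2 n P \<longleftrightarrow>
     (\<forall>q b c. q \<noteq> 0 \<and> b \<noteq> 0 \<and> c \<noteq> 0 \<and> br q \<noteq> 0 \<and> br (b / q) \<noteq> 0 \<and> br (c / q) \<noteq> 0 \<longrightarrow>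
        (\<exists>L. Z_UU2_limit n q b c L \<and>
             eval3 P ((br (q^2) / br q)^2) (br (b * q) / br (b / q)) (br (c * q) / br (c / q)) =
               br (q^2) ^ (2 * n) * L
               / (br q ^ (n * (2 * n + 1)) * (br (b / q) * br (c / q)) ^ n)))"

text \<open>The argument is \<open>n\<close>, not \<open>4n\<close>: \<open>A_UU2 n\<close> is \<open>A(4n;t,y,z)\<close>.\<close>

definition A_UU2 :: "nat \<Rightarrow> poly3" where
  "A_UU2 n = (THE P. is_A_UU2 n P)"

end

theory Submission
  imports Defs
begin

text \<open>
  In the variables \<open>u = ([y]/[q])\<^sup>2\<close> and \<open>v = ([x]/[q])\<^sup>2\<close>, the entry of the determinant is
  \<open>-[x\<^sup>2][y\<^sup>2]/[q]\<^sup>3\<close> times \<open>G(u,v) = N(u,v)/D(u,v)\<close>, where \<open>D = (1-u-v)\<^sup>2 - t u v\<close> and \<open>N\<close> is linear.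
  Newton interpolation at the nodes factors the matrix \<open>G(u\<^sub>i,v\<^sub>j)\<close> as \<open>L \<Gamma> R\<^sup>T\<close>, with \<open>L\<close>, \<open>R\<close> lower
  triangular and \<open>\<Gamma>\<close> the matrix of divided differences. The determinants of \<open>L\<close> and \<open>R\<close> are
  Vandermonde products which cancel the denominator of \<open>Z\<close>. The relation \<open>D G = N\<close> turns into a
  recursion for the divided differences; hence they depend continuously on the nodes, and at \<open>u = v = 0\<close>
  they are the Taylor coefficients of \<open>N/D\<close>, i.e. up to a constant factor the binomial sums.
  The polynomial is unique because its values are prescribed for infinitely many \<open>t\<close>
  and, for each of these, for all \<open>y, z\<close> from an infinite set.
\<close>

subsection \<open>Bivariate Newton interpolation of a rational function\<close>

text \<open>
  An array \<open>g\<close> stands for the series \<open>\<Sum> g k l * newton_basis u k U * newton_basis v l V\<close>, where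
  \<open>newton_basis u k U = (U - u 0) \<dots> (U - u (k - 1))\<close>. On it, \<open>shift_fst\<close> is multiplication by \<open>U\<close>,
  \<open>shift_snd\<close> by \<open>V\<close>, \<open>shift_compl\<close> by \<open>1 - U - V\<close> and \<open>denom_shift\<close> by
  \<open>(1 - U - V)\<^sup>2 - t U V\<close>.
\<close>

definition shift_fst :: "(nat \<Rightarrow> 'a::field) \<Rightarrow> (nat \<Rightarrow> nat \<Rightarrow> 'a) \<Rightarrow> nat \<Rightarrow> nat \<Rightarrow> 'a" where
  "shift_fst u g i j = (if i = 0 then 0 else g (i - 1) j) + u i * g i j"

definition shift_snd :: "(nat \<Rightarrow> 'a::field) \<Rightarrow> (nat \<Rightarrow> nat \<Rightarrow> 'a) \<Rightarrow> nat \<Rightarrow> nat \<Rightarrow> 'a" where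
  "shift_snd v g i j = (if j = 0 then 0 else g i (j - 1)) + v j * g i j"

definition shift_compl ::
  "(nat \<Rightarrow> 'a::field) \<Rightarrow> (nat \<Rightarrow> 'a) \<Rightarrow> (nat \<Rightarrow> nat \<Rightarrow> 'a) \<Rightarrow> nat \<Rightarrow> nat \<Rightarrow> 'a" where
  "shift_compl u v g i j = g i j - shift_fst u g i j - shift_snd v g i j"

definition denom_shift ::
  "'a::field \<Rightarrow> (nat \<Rightarrow> 'a) \<Rightarrow> (nat \<Rightarrow> 'a) \<Rightarrow> (nat \<Rightarrow> nat \<Rightarrow> 'a) \<Rightarrow> nat \<Rightarrow> nat \<Rightarrow> 'a" where
  "denom_shift t u v g i j = shift_compl u v (shift_compl u v g) i j
     - t * shift_fst u (shift_snd v g) i j"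

definition unit_array :: "nat \<Rightarrow> nat \<Rightarrow> 'a::field" where
  "unit_array i j = (if i = 0 \<and> j = 0 then 1 else 0)"

text \<open>The basis \<open>1 - U - V\<close>, \<open>U\<close>, \<open>V\<close> of the linear
  polynomials is used because the quotient of each by the denominator has explicit Taylor
  coefficients at the origin.\<close>

definition numer_array ::
  "'a::field \<Rightarrow> 'a \<Rightarrow> 'a \<Rightarrow> (nat \<Rightarrow> 'a) \<Rightarrow> (nat \<Rightarrow> 'a) \<Rightarrow> nat \<Rightarrow> nat \<Rightarrow> 'a" where
  "numer_array A B C u v i j = A * shift_compl u v unit_array i j
     + B * shift_fst u unit_array i j + C * shift_snd v unit_array i j"

definition denom :: "'a::field \<Rightarrow> 'a \<Rightarrow> 'a \<Rightarrow> 'a" where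
  "denom t u v = (1 - u - v)\<^sup>2 - t * u * v"

definition numer :: "'a::field \<Rightarrow> 'a \<Rightarrow> 'a \<Rightarrow> 'a \<Rightarrow> 'a \<Rightarrow> 'a" where
  "numer A B C u v = A * (1 - u - v) + B * u + C * v"

definition newton_basis :: "(nat \<Rightarrow> 'a::field) \<Rightarrow> nat \<Rightarrow> 'a \<Rightarrow> 'a" where
  "newton_basis u k z = (\<Prod>m<k. z - u m)"

text \<open>The value of the series at \<open>(u i, v j)\<close>: cutting it at \<open>i\<close> and
  \<open>j\<close> is exact, because all later basis polynomials vanish at these nodes.\<close>

definition newton_eval ::
  "(nat \<Rightarrow> 'a::field) \<Rightarrow> (nat \<Rightarrow> 'a) \<Rightarrow> (nat \<Rightarrow> nat \<Rightarrow> 'a) \<Rightarrow> nat \<Rightarrow> nat \<Rightarrow> 'a" where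
  "newton_eval u v g i j =
     (\<Sum>k\<le>i. \<Sum>l\<le>j. newton_basis u k (u i) * newton_basis v l (v j) * g k l)"

lemma newton_basis_node: "i < k \<Longrightarrow> newton_basis u k (u i) = 0"
  by (auto simp: newton_basis_def)

text \<open>Write \<open>z = (z - u k) + u k\<close>: the first summand turns basis polynomial
  \<open>k\<close> into number \<open>k + 1\<close>. Cutting at \<open>i\<close> costs one boundary
  term, which vanishes at \<open>z = u i\<close>.\<close>

lemma newton_sum_shift:
  fixes f :: "nat \<Rightarrow> 'a::field"
  shows "(\<Sum>k\<le>i. newton_basis u k z * ((if k = 0 then 0 else f (k - 1)) + u k * f k))
    = z * (\<Sum>k\<le>i. newton_basis u k z * f k) - newton_basis u (Suc i) z * f i"
  by (induction i) (simp_all add: newton_basis_def algebra_simps)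

lemma newton_eval_shift_fst: "newton_eval u v (shift_fst u g) i j = u i * newton_eval u v g i j"
proof -
  \<comment> \<open>The sum over \<open>k\<close>, the index that is shifted, has to be innermost
    for \<open>newton_sum_shift\<close>.\<close>
  have *: "newton_eval u v h i j =
      (\<Sum>l\<le>j. newton_basis v l (v j) * (\<Sum>k\<le>i. newton_basis u k (u i) * h k l))" for h
    unfolding newton_eval_def
    by (subst sum.swap) (simp add: sum_distrib_left mult_ac)
  show ?thesis
    unfolding * shift_fst_def newton_sum_shift[where f = "\<lambda>k. g k _"]
    by (simp add: newton_basis_node sum_distrib_left mult_ac)
qed

lemma newton_eval_shift_snd: "newton_eval u v (shift_snd v g) i j = v j * newton_eval u v g i j"
proof -
  have *: "newton_eval u v h i j =
      (\<Sum>k\<le>i. newton_basis u k (u i) * (\<Sum>l\<le>j. newton_basis v l (v j) * h k l))" for h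
    unfolding newton_eval_def
    by (simp add: sum_distrib_left mult_ac)
  show ?thesis
    unfolding * shift_snd_def newton_sum_shift
    by (simp add: newton_basis_node sum_distrib_left mult_ac)
qed

lemma newton_eval_unit_array: "newton_eval u v unit_array i j = 1"
proof -
  have "newton_eval u v unit_array i j = (\<Sum>k\<le>i. \<Sum>l\<le>j. if l = 0 then (if k = 0 then 1 else 0) else 0)"
    unfolding newton_eval_def unit_array_def
    by (intro sum.cong refl) (simp add: newton_basis_def)
  then show ?thesis by simp
qed

lemma newton_eval_shift_compl:
  "newton_eval u v (shift_compl u v g) i j = (1 - u i - v j) * newton_eval u v g i j"
proof -
  have "newton_eval u v (shift_compl u v g) i j = newton_eval u v g i j
      - newton_eval u v (shift_fst u g) i j - newton_eval u v (shift_snd v g) i j"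
    unfolding newton_eval_def shift_compl_def
    by (simp add: sum_subtractf right_diff_distrib)
  then show ?thesis
    by (simp add: newton_eval_shift_fst newton_eval_shift_snd algebra_simps)
qed

lemma newton_eval_denom_shift:
  "newton_eval u v (denom_shift t u v g) i j = denom t (u i) (v j) * newton_eval u v g i j"
proof -
  have "newton_eval u v (denom_shift t u v g) i j =
      newton_eval u v (shift_compl u v (shift_compl u v g)) i j
      - t * newton_eval u v (shift_fst u (shift_snd v g)) i j"
    unfolding newton_eval_def denom_shift_def
    by (simp add: sum_subtractf right_diff_distrib sum_distrib_left mult_ac)
  then show ?thesis
    by (simp add: newton_eval_shift_fst newton_eval_shift_snd newton_eval_shift_compl denom_def
        power2_eq_square algebra_simps)
qed

lemma newton_eval_numer_array:
  "newton_eval u v (numer_array A B C u v) i j = numer A B C (u i) (v j)"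
proof -
  have "newton_eval u v (numer_array A B C u v) i j =
      A * newton_eval u v (shift_compl u v unit_array) i j
      + B * newton_eval u v (shift_fst u unit_array) i j
      + C * newton_eval u v (shift_snd v unit_array) i j"
    unfolding newton_eval_def numer_array_def
    by (simp add: sum.distrib ring_distribs sum_distrib_left mult_ac)
  then show ?thesis
    by (simp add: newton_eval_shift_fst newton_eval_shift_snd newton_eval_shift_compl
        newton_eval_unit_array numer_def)
qed

text \<open>
  The recursion is \<open>denom_shift t u v g = f\<close> solved for \<open>g i j\<close>, so at \<open>u = v = 0\<close> it computes
  Taylor coefficients; the values are junk once some \<open>denom t (u i) (v j)\<close> vanishes.
\<close>

fun newton_coeff ::
  "'a::field \<Rightarrow> (nat \<Rightarrow> nat \<Rightarrow> 'a) \<Rightarrow> (nat \<Rightarrow> 'a) \<Rightarrow> (nat \<Rightarrow> 'a) \<Rightarrow> nat \<Rightarrow> nat \<Rightarrow> 'a" where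
  [simp del]: "newton_coeff t f u v i j =
     (f i j
      - (if i = 0 then 0 else
          (u (i - 1) + u i - 2 + (2 - t) * v j) * newton_coeff t f u v (i - 1) j)
      - (if j = 0 then 0 else
          (v (j - 1) + v j - 2 + (2 - t) * u i) * newton_coeff t f u v i (j - 1))
      - (if i < 2 then 0 else newton_coeff t f u v (i - 2) j)
      - (if j < 2 then 0 else newton_coeff t f u v i (j - 2))
      - (if i = 0 \<or> j = 0 then 0 else (2 - t) * newton_coeff t f u v (i - 1) (j - 1)))
     / denom t (u i) (v j)"

text \<open>The denominator is \<open>1 - 2U - 2V + U^2 + V^2 + (2 - t)UV\<close>. No monomial
  lowers an index by more than two, so the cases 0, 1 and at least 2 suffice.\<close>

lemma denom_shift_expand:
  "denom_shift t u v g i j = denom t (u i) (v j) * g i j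
      + (if i = 0 then 0 else (u (i - 1) + u i - 2 + (2 - t) * v j) * g (i - 1) j)
      + (if j = 0 then 0 else (v (j - 1) + v j - 2 + (2 - t) * u i) * g i (j - 1))
      + (if i < 2 then 0 else g (i - 2) j)
      + (if j < 2 then 0 else g i (j - 2))
      + (if i = 0 \<or> j = 0 then 0 else (2 - t) * g (i - 1) (j - 1))"
proof -
  have i: "i = 0 \<or> i = 1 \<or> (\<exists>k. i = Suc (Suc k))" by presburger
  have j: "j = 0 \<or> j = 1 \<or> (\<exists>k. j = Suc (Suc k))" by presburger
  from i j show ?thesis
    by (elim disjE exE)
      (simp_all add: denom_shift_def shift_compl_def shift_fst_def shift_snd_def denom_def
        power2_eq_square algebra_simps)
qed

lemma denom_shift_newton_coeff:
  assumes "denom t (u i) (v j) \<noteq> 0"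
  shows "denom_shift t u v (newton_coeff t f u v) i j = f i j"
  unfolding denom_shift_expand
  by (subst newton_coeff.simps) (use assms in simp)

text \<open>The relation is triangular: every other entry in it has a smaller \<open>i + j\<close>.
  It is required only below \<open>n\<close> because truncated sums satisfy it only in such a
  range.\<close>

lemma newton_coeff_unique:
  assumes "\<And>i j. i < n \<Longrightarrow> j < n \<Longrightarrow> denom t (u i) (v j) \<noteq> 0"
    and "\<And>i j. i < n \<Longrightarrow> j < n \<Longrightarrow> denom_shift t u v g i j = f i j"
    and "i < n" "j < n"
  shows "newton_coeff t f u v i j = g i j"
  using assms(3,4)
proof (induction "i + j" arbitrary: i j rule: less_induct)
  case less
  have IH: "newton_coeff t f u v k l = g k l" if "k + l < i + j" "k \<le> i" "l \<le> j" for k l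
    using less that by auto
  have "f i j = denom_shift t u v g i j"
    using assms(2) less.prems by simp
  then show ?case
    unfolding denom_shift_expand using assms(1) less.prems
    by (subst newton_coeff.simps) (auto simp: IH field_simps)
qed

text \<open>Evaluation turns \<open>denom_shift\<close> into multiplication by the denominator, so
  the equation for the coefficients becomes one for the values. Every coefficient up to
  \<open>(i, j)\<close> enters, hence the assumption on all these denominators.\<close>

lemma newton_eval_newton_coeff:
  assumes "\<And>k l. k \<le> i \<Longrightarrow> l \<le> j \<Longrightarrow> denom t (u k) (v l) \<noteq> 0"
  shows "newton_eval u v (newton_coeff t (numer_array A B C u v) u v) i j
    = numer A B C (u i) (v j) / denom t (u i) (v j)"
proof -
  let ?g = "newton_coeff t (numer_array A B C u v) u v"
  have "denom t (u i) (v j) * newton_eval u v ?g i j = newton_eval u v (denom_shift t u v ?g) i j"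
    by (rule newton_eval_denom_shift[symmetric])
  also have "\<dots> = newton_eval u v (numer_array A B C u v) i j"
    unfolding newton_eval_def using assms
    by (intro sum.cong refl) (simp add: denom_shift_newton_coeff)
  finally show ?thesis
    using assms[of i j] by (simp add: newton_eval_numer_array field_simps)
qed

text \<open>The nodes may collide in the limit: unlike difference quotients, the recursion divides
  only by \<open>denom\<close>, which is nonzero at the limit.\<close>

lemma tendsto_newton_coeff:
  fixes u v :: "'b \<Rightarrow> nat \<Rightarrow> 'a::real_normed_field"
  assumes u: "\<And>i. i < n \<Longrightarrow> ((\<lambda>p. u p i) \<longlongrightarrow> u0 i) F"
    and v: "\<And>j. j < n \<Longrightarrow> ((\<lambda>p. v p j) \<longlongrightarrow> v0 j) F"
    and f: "\<And>i j. i < n \<Longrightarrow> j < n \<Longrightarrow> ((\<lambda>p. f p i j) \<longlongrightarrow> f0 i j) F"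
    and nz: "\<And>i j. i < n \<Longrightarrow> j < n \<Longrightarrow> denom t (u0 i) (v0 j) \<noteq> 0"
    and "i < n" "j < n"
  shows "((\<lambda>p. newton_coeff t (f p) (u p) (v p) i j) \<longlongrightarrow> newton_coeff t f0 u0 v0 i j) F"
  using assms(5,6)
proof (induction "i + j" arbitrary: i j rule: less_induct)
  case less
  have IH: "((\<lambda>p. newton_coeff t (f p) (u p) (v p) k l) \<longlongrightarrow> newton_coeff t f0 u0 v0 k l) F"
    if "k + l < i + j" "k \<le> i" "l \<le> j" for k l
    using less that by auto
  have [tendsto_intros]: "((\<lambda>p. u p k) \<longlongrightarrow> u0 k) F" if "k \<le> i" for k
    using that less.prems u by simp
  have [tendsto_intros]: "((\<lambda>p. v p k) \<longlongrightarrow> v0 k) F" if "k \<le> j" for k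
    using that less.prems v by simp
  have ifI: "((\<lambda>p. if P then c else h p) \<longlongrightarrow> (if P then c else l)) F"
    if "\<not> P \<Longrightarrow> (h \<longlongrightarrow> l) F" for P and c l :: 'a and h
    using that by simp
  have D: "((\<lambda>p. denom t (u p i) (v p j)) \<longlongrightarrow> denom t (u0 i) (v0 j)) F"
    unfolding denom_def by (intro tendsto_intros) auto
  show ?case
    unfolding newton_coeff.simps[of t _ _ _ i j]
    by (intro tendsto_divide tendsto_diff ifI tendsto_mult IH D f nz less.prems tendsto_intros) auto
qed

text \<open>Expansion in the two Newton bases is a product of three matrices. The outer ones are
  triangular, carry the products of node differences on their diagonals and absorb the factors
  \<open>r\<close> and \<open>s\<close>.\<close>

lemma det_newton_eval:
  fixes u v :: "nat \<Rightarrow> 'a::field"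
  shows "Determinant.det (Matrix.mat n n (\<lambda>(i, j). r i * s j * newton_eval u v g i j)) =
    (\<Prod>i<n. r i) * (\<Prod>i<n. s i) * (\<Prod>i<n. \<Prod>m<i. (u i - u m) * (v i - v m))
      * Determinant.det (Matrix.mat n n (\<lambda>(i, j). g i j))"
proof -
  define L where "L w h = Matrix.mat n n (\<lambda>(i, k). w i * newton_basis h k (h i))"
    for w h :: "nat \<Rightarrow> 'a"
  have [simp]: "L w h \<in> carrier_mat n n" for w h by (simp add: L_def)

  have det_L: "Determinant.det (L w h) = (\<Prod>i<n. w i) * (\<Prod>i<n. \<Prod>m<i. h i - h m)" for w h
  proof -
    have "Determinant.det (L w h) = prod_list (diag_mat (L w h))"
      by (rule det_lower_triangular[of n]) (auto simp: L_def newton_basis_node)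
    also have "\<dots> = (\<Prod>i<n. w i * (\<Prod>m<i. h i - h m))"
      by (simp add: prod_list_diag_prod L_def newton_basis_def lessThan_atLeast0)
    finally show ?thesis by (simp add: prod.distrib)
  qed
  let ?G = "Matrix.mat n n (\<lambda>(i, j). g i j)"
  have "Matrix.mat n n (\<lambda>(i, j). r i * s j * newton_eval u v g i j)
      = L r u * ?G * (L s v)\<^sup>T" (is "?M = _")
  proof (rule eq_matI)
    fix i j assume "i < dim_row (L r u * ?G * (L s v)\<^sup>T)" "j < dim_col (L r u * ?G * (L s v)\<^sup>T)"
    then have ij: "i < n" "j < n" by (simp_all add: L_def)
    \<comment> \<open>The sums extend to all indices below \<open>n\<close>, since the added basis
      polynomials vanish at the nodes.\<close>
    have "newton_eval u v g i j =
        (\<Sum>k<n. \<Sum>l<n. newton_basis u k (u i) * newton_basis v l (v j) * g k l)"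
      unfolding newton_eval_def using ij
      by (intro sum.mono_neutral_cong_left) (auto simp: newton_basis_node intro!: sum.mono_neutral_left)
    then have "r i * s j * newton_eval u v g i j =
        (\<Sum>l<n. \<Sum>k<n. r i * newton_basis u k (u i) * g k l * (s j * newton_basis v l (v j)))"
      by (subst sum.swap) (simp add: sum_distrib_left mult_ac)
    then show "?M $$ (i, j) = (L r u * ?G * (L s v)\<^sup>T) $$ (i, j)"
      using ij by (simp add: L_def scalar_prod_def sum_distrib_left lessThan_atLeast0 mult_ac)
  qed (simp_all add: L_def)
  moreover have "L r u * ?G \<in> carrier_mat n n" "?G \<in> carrier_mat n n"
    by (auto intro!: mult_carrier_mat[of _ n n])
  ultimately show ?thesis
    by (simp add: det_mult[of _ n] det_transpose[of _ n] det_L prod.distrib mult_ac)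
qed

subsection \<open>Trinomial expansion at the origin\<close>

text \<open>
  With \<open>D = (1 - u - v)\<^sup>2 - t u v\<close>, the coefficients of \<open>u^i v^j\<close> in \<open>(1 - u - v) / D\<close>, \<open>u / D\<close> and
  \<open>v / D\<close>; the products of binomials are trinomial coefficients, and the sums are complete once
  \<open>i, j \<le> m\<close>.
\<close>

definition trinomial_even :: "nat \<Rightarrow> 'a::field \<Rightarrow> nat \<Rightarrow> nat \<Rightarrow> 'a" where
  "trinomial_even m t i j =
     (\<Sum>k\<le>m. of_nat ((i + j) choose (i + k)) * of_nat ((i + k) choose (2 * k)) * t ^ k)"

definition trinomial_fst :: "nat \<Rightarrow> 'a::field \<Rightarrow> nat \<Rightarrow> nat \<Rightarrow> 'a" where
  "trinomial_fst m t i j =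
     (\<Sum>k\<le>m. of_nat ((i + j) choose (i + k)) * of_nat ((i + k) choose (2 * k + 1)) * t ^ k)"

definition trinomial_snd :: "nat \<Rightarrow> 'a::field \<Rightarrow> nat \<Rightarrow> nat \<Rightarrow> 'a" where
  "trinomial_snd m t i j =
     (\<Sum>k\<le>m. of_nat ((i + j) choose (i + k + 1)) * of_nat ((i + k + 1) choose (2 * k + 1)) * t ^ k)"

abbreviation zero_seq :: "nat \<Rightarrow> 'a::field" where
  "zero_seq \<equiv> (\<lambda>_. 0)"

lemma sum_shift_top_zero:
  fixes f :: "nat \<Rightarrow> 'a::comm_monoid_add"
  assumes "f m = 0"
  shows "(\<Sum>k\<le>m. if k = 0 then 0 else f (k - 1)) = (\<Sum>k\<le>m. f k)"
proof (cases m)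
  case (Suc l)
  have "(\<Sum>k\<le>m. if k = 0 then 0 else f (k - 1)) = (\<Sum>k\<le>l. f k)"
    unfolding Suc by (subst sum.atMost_Suc_shift) simp
  then show ?thesis using assms Suc by simp
qed (use assms in simp)

text \<open>This is \<open>(1 - u - v)^2 / D = 1 + t u v / D\<close>. The coefficient
  \<open>(i+j)! / ((i-k)! (j-k)! (2k)!)\<close> obeys Pascal's rule in three directions; lowering
  \<open>2k\<close> to \<open>2k - 1\<close> yields the term \<open>k - 1\<close> of
  \<open>u / D\<close>, whence the factor \<open>t\<close>.\<close>

lemma shift_compl_trinomial_even:
  assumes "i \<le> m" "j \<le> m"
  shows "shift_compl zero_seq zero_seq (trinomial_even m t) i j
    = unit_array i j + t * shift_snd zero_seq (trinomial_fst m t) i j"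
proof (cases "i = 0 \<or> j = 0")
  case False
  then obtain i' j' where ij: "i = Suc i'" "j = Suc j'"
    by (meson not0_implies_Suc)
  let ?f = "\<lambda>k. of_nat ((i + j') choose (i + k)) * of_nat ((i + k) choose (2 * k + 1)) * t ^ Suc k"
  \<comment> \<open>Since \<open>i\<close> is at most \<open>m\<close>, shifting \<open>k\<close> in
    the truncated sum loses nothing at the top.\<close>
  have top: "?f m = 0" using assms by (simp add: binomial_eq_0)
  have "trinomial_even m t i j =
      (\<Sum>k\<le>m. of_nat ((i' + j) choose (i' + k)) * of_nat ((i' + k) choose (2 * k)) * t ^ k
        + of_nat ((i + j') choose (i + k)) * of_nat ((i + k) choose (2 * k)) * t ^ k
        + (if k = 0 then 0 else ?f (k - 1)))"
    unfolding trinomial_even_def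
  proof (intro sum.cong refl)
    fix k
    show "of_nat ((i + j) choose (i + k)) * of_nat ((i + k) choose (2 * k)) * t ^ k =
        of_nat ((i' + j) choose (i' + k)) * of_nat ((i' + k) choose (2 * k)) * t ^ k
        + of_nat ((i + j') choose (i + k)) * of_nat ((i + k) choose (2 * k)) * t ^ k
        + (if k = 0 then 0 else ?f (k - 1))"
      by (cases k) (simp_all add: ij algebra_simps)
  qed
  also have "\<dots> = trinomial_even m t i' j + trinomial_even m t i j' + (\<Sum>k\<le>m. ?f k)"
    unfolding sum.distrib sum_shift_top_zero[of ?f, OF top] by (simp add: trinomial_even_def)
  also have "(\<Sum>k\<le>m. ?f k) = t * trinomial_fst m t i j'"
    by (simp add: trinomial_fst_def sum_distrib_left mult_ac)
  finally show ?thesis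
    by (simp add: ij shift_compl_def shift_fst_def shift_snd_def unit_array_def algebra_simps)
next
  case True
  have 0: "trinomial_even m t i 0 = 1" for i
  proof -
    have "trinomial_even m t i 0 = (\<Sum>k\<le>m. if k = 0 then 1 else 0)"
      unfolding trinomial_even_def by (intro sum.cong refl) (auto simp: binomial_eq_0)
    then show ?thesis by simp
  qed
  have 1: "trinomial_even m t 0 j = 1" for j
  proof -
    have "trinomial_even m t 0 j = (\<Sum>k\<le>m. if k = 0 then 1 else 0)"
      unfolding trinomial_even_def by (intro sum.cong refl) (auto simp: binomial_eq_0)
    then show ?thesis by simp
  qed
  have 2: "trinomial_fst m t 0 j = 0" for j
    unfolding trinomial_fst_def by (intro sum.neutral) (auto simp: binomial_eq_0)
  from True show ?thesis
    by (auto simp: 0 1 2 shift_compl_def shift_fst_def shift_snd_def unit_array_def)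
qed

text \<open>This is \<open>(1 - u - v) * (u / D) = u * ((1 - u - v) / D)\<close>. Pascal's rule
  lowers \<open>2k + 1\<close> to \<open>2k\<close> with the same \<open>k\<close>, so the identity
  holds term by term.\<close>

lemma shift_compl_trinomial_fst:
  "shift_compl zero_seq zero_seq (trinomial_fst m t) i j
    = shift_fst zero_seq (trinomial_even m t) i j"
proof (cases "i = 0 \<or> j = 0")
  case False
  then obtain i' j' where ij: "i = Suc i'" "j = Suc j'"
    by (meson not0_implies_Suc)
  have "trinomial_fst m t i j = trinomial_fst m t i' j + trinomial_fst m t i j'
      + trinomial_even m t i' j"
    unfolding trinomial_fst_def trinomial_even_def sum.distrib[symmetric]
    by (intro sum.cong refl) (simp add: ij algebra_simps)
  then show ?thesis
    by (simp add: ij shift_compl_def shift_fst_def shift_snd_def)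
next
  case True
  have 0: "trinomial_fst m t (Suc i) 0 = trinomial_fst m t i 0 + trinomial_even m t i 0" for i
    unfolding trinomial_fst_def trinomial_even_def sum.distrib[symmetric]
    by (intro sum.cong refl) (auto simp: algebra_simps binomial_eq_0)
  have 2: "trinomial_fst m t 0 j = 0" for j
    unfolding trinomial_fst_def by (intro sum.neutral) (auto simp: binomial_eq_0)
  from True show ?thesis
    by (cases i) (auto simp: 0 2 shift_compl_def shift_fst_def shift_snd_def)
qed

text \<open>The mirror image of the preceding identity, with \<open>v / D\<close> in place of
  \<open>u / D\<close>.\<close>

lemma shift_compl_trinomial_snd:
  "shift_compl zero_seq zero_seq (trinomial_snd m t) i j
    = shift_snd zero_seq (trinomial_even m t) i j"
proof (cases "i = 0 \<or> j = 0")
  case False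
  then obtain i' j' where ij: "i = Suc i'" "j = Suc j'"
    by (meson not0_implies_Suc)
  have "trinomial_snd m t i j = trinomial_snd m t i' j + trinomial_snd m t i j'
      + trinomial_even m t i j'"
    unfolding trinomial_snd_def trinomial_even_def sum.distrib[symmetric]
    by (intro sum.cong refl) (simp add: ij algebra_simps)
  then show ?thesis
    by (simp add: ij shift_compl_def shift_fst_def shift_snd_def)
next
  case True
  have 0: "trinomial_snd m t 0 (Suc j) = trinomial_snd m t 0 j + trinomial_even m t 0 j" for j
    unfolding trinomial_snd_def trinomial_even_def sum.distrib[symmetric]
    by (intro sum.cong refl) (auto simp: algebra_simps binomial_eq_0)
  have 2: "trinomial_snd m t i 0 = 0" for i
    unfolding trinomial_snd_def by (intro sum.neutral) (auto simp: binomial_eq_0)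
  from True show ?thesis
    by (cases j) (auto simp: 0 2 shift_compl_def shift_fst_def shift_snd_def)
qed

definition trinomial_comb :: "nat \<Rightarrow> 'a::field \<Rightarrow> 'a \<Rightarrow> 'a \<Rightarrow> 'a \<Rightarrow> nat \<Rightarrow> nat \<Rightarrow> 'a" where
  "trinomial_comb m A B C t i j =
     A * trinomial_even m t i j + B * trinomial_fst m t i j + C * trinomial_snd m t i j"

text \<open>Multiplying twice by \<open>1 - U - V\<close> with the three recurrences gives the
  numerator and terms with factor \<open>t\<close>; the latter cancel against
  \<open>t U V\<close>.\<close>

lemma denom_shift_trinomial_comb:
  assumes "i \<le> m" "j \<le> m"
  shows "denom_shift t zero_seq zero_seq (trinomial_comb m A B C t) i j
    = numer_array A B C zero_seq zero_seq i j"
proof -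
  let ?z = "zero_seq :: nat \<Rightarrow> 'a"
  let ?M = "shift_compl ?z ?z" and ?U = "shift_fst ?z" and ?V = "shift_snd ?z"
  let ?a = "trinomial_even m t" and ?b = "trinomial_fst m t" and ?c = "trinomial_snd m t"
  \<comment> \<open>A shift at \<open>(i, j)\<close> sees only entries with indices up to
    \<open>i\<close> and \<open>j\<close>, where the bounded recurrence for
    \<open>trinomial_even\<close> is available.\<close>
  have M_cong: "?M f i j = ?M g i j" if "\<And>k l. k \<le> i \<Longrightarrow> l \<le> j \<Longrightarrow> f k l = g k l" for f g
    using that by (simp add: shift_compl_def shift_fst_def shift_snd_def)
  have MM: "?M (?M (trinomial_comb m A B C t)) i j =
     ?M (\<lambda>k l. A * (unit_array k l + t * ?V ?b k l) + B * ?U ?a k l + C * ?V ?a k l) i j"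
  proof (rule M_cong)
    fix k l assume "k \<le> i" "l \<le> j"
    then have kl: "k \<le> m" "l \<le> m" using assms by auto
    have "?M (trinomial_comb m A B C t) k l = A * ?M ?a k l + B * ?M ?b k l + C * ?M ?c k l"
      by (simp add: trinomial_comb_def shift_compl_def shift_fst_def shift_snd_def algebra_simps)
    then show "?M (trinomial_comb m A B C t) k l =
        A * (unit_array k l + t * ?V ?b k l) + B * ?U ?a k l + C * ?V ?a k l"
      using kl by (simp add: shift_compl_trinomial_even shift_compl_trinomial_fst
          shift_compl_trinomial_snd)
  qed
  have Ub: "?M ?b k l = ?U ?a k l" and Uc: "?M ?c k l = ?V ?a k l" for k l
    by (rule shift_compl_trinomial_fst shift_compl_trinomial_snd)+
  have a: "?M ?a k l = unit_array k l + t * ?V ?b k l" if "k \<le> i" "l \<le> j" for k l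
    using that assms by (intro shift_compl_trinomial_even) auto
  have "?M (\<lambda>k l. A * (unit_array k l + t * ?V ?b k l) + B * ?U ?a k l + C * ?V ?a k l) i j
      = A * (?M unit_array i j + t * ?V (?M ?b) i j) + B * ?U (?M ?a) i j + C * ?V (?M ?a) i j"
    by (simp add: shift_compl_def shift_fst_def shift_snd_def algebra_simps)
  also have "?V (?M ?b) i j = ?V (?U ?a) i j"
    unfolding shift_snd_def by (simp add: Ub)
  also have "?U (?M ?a) i j = ?U (\<lambda>k l. unit_array k l + t * ?V ?b k l) i j"
    unfolding shift_fst_def by (simp add: a)
  also have "?V (?M ?a) i j = ?V (\<lambda>k l. unit_array k l + t * ?V ?b k l) i j"
    unfolding shift_snd_def[of _ "?M ?a"] shift_snd_def[of _ "\<lambda>k l. unit_array k l + t * ?V ?b k l"]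
    by (simp add: a)
  finally have *: "?M (?M (trinomial_comb m A B C t)) i j = 
     A * (?M unit_array i j + t * ?V (?U ?a) i j)
     + B * ?U (\<lambda>k l. unit_array k l + t * ?V ?b k l) i j
     + C * ?V (\<lambda>k l. unit_array k l + t * ?V ?b k l) i j"
    unfolding MM .
  \<comment> \<open>Both sides are the coefficients of \<open>u v / D\<close>.\<close>
  have Uc_Vb: "?U ?c k l = ?V ?b k l" for k l
  proof (cases "k = 0 \<or> l = 0")
    case False
    then show ?thesis
      by (auto simp: shift_fst_def shift_snd_def trinomial_fst_def trinomial_snd_def gr0_conv_Suc)
  next
    case True
    have "?b 0 l = 0" "?c k 0 = 0" for k l
      unfolding trinomial_fst_def trinomial_snd_def by (auto intro!: sum.neutral simp: binomial_eq_0)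
    with True show ?thesis
      by (auto simp: shift_fst_def shift_snd_def)
  qed
  have commute: "?U (?V f) i j = ?V (?U f) i j" for f
    by (simp add: shift_fst_def shift_snd_def)
  have VVb: "?V (?V ?b) i j = ?U (?V ?c) i j"
    unfolding commute shift_snd_def[of _ "?V ?b"] shift_snd_def[of _ "?U ?c"] by (simp add: Uc_Vb)
  have "denom_shift t ?z ?z (trinomial_comb m A B C t) i j =
      A * (?M unit_array i j + t * ?V (?U ?a) i j)
      + B * (?U unit_array i j + t * ?U (?V ?b) i j)
      + C * (?V unit_array i j + t * ?V (?V ?b) i j)
      - t * (A * ?U (?V ?a) i j + B * ?U (?V ?b) i j + C * ?U (?V ?c) i j)"
    unfolding denom_shift_def *
    by (simp add: trinomial_comb_def shift_fst_def shift_snd_def algebra_simps)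
  then show ?thesis
    by (simp add: numer_array_def VVb commute algebra_simps)
qed

subsection \<open>Reduction of the partition function\<close>

text \<open>The product depends on \<open>x\<close> and \<open>y\<close> only through
  \<open>[x]^2\<close> and \<open>[y]^2\<close>; divided by \<open>[q]^4\<close>, it becomes
  \<open>denom\<close> with \<open>t = (q + 1/q)^2\<close>.\<close>

lemma br_prod_eq:
  fixes q x y :: complex
  assumes "q \<noteq> 0" "x \<noteq> 0" "y \<noteq> 0"
  shows "br (q * x / y) * br (q * y / x) * br (q * x * y) * br (q / (x * y)) =
    (br q ^ 2 - br x ^ 2 - br y ^ 2) ^ 2 - (q + inverse q) ^ 2 * br x ^ 2 * br y ^ 2"
proof -
  \<comment> \<open>Inverses become separate variables subject to \<open>q * q' = 1\<close> and the
    like, so that plain expansion decides the identity.\<close>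
  have id: "(q * x * y' - q' * x' * y) * (q * y * x' - q' * y' * x) * (q * x * y - q' * x' * y')
      * (q * x' * y' - q' * x * y) =
    ((q - q')\<^sup>2 - (x - x')\<^sup>2 - (y - y')\<^sup>2)\<^sup>2 - (q + q')\<^sup>2 * (x - x')\<^sup>2 * (y - y')\<^sup>2"
    if i: "q * q' = 1" "x * x' = 1" "y * y' = 1" for q' x' y' :: complex
  proof -
    \<comment> \<open>These forms cancel a pair inside a right-nested product, where the equations
      \<open>i\<close> do not match.\<close>
    have j: "q * (q' * w) = w" "x * (x' * w) = w" "y * (y' * w) = w" for w
      using i by (metis mult.assoc mult_1)+
    show ?thesis
      by (simp add: algebra_simps power2_eq_square i j)
  qed
  show ?thesis
    using id[of "inverse q" "inverse x" "inverse y"] assms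
    by (simp add: br_def divide_inverse mult_ac)
qed

text \<open>The numerator of the entry over the common denominator changes sign under
  \<open>x -> 1/x\<close> and under \<open>y -> 1/y\<close>, which explains the factors
  \<open>[x^2]\<close> and \<open>[y^2]\<close>. The cofactor is linear in \<open>[x]^2\<close> and
  \<open>[y]^2\<close>.\<close>

lemma numerator_identity:
  fixes q b c x y :: complex
  assumes "q \<noteq> 0" "x \<noteq> 0" "y \<noteq> 0" "b \<noteq> 0" "c \<noteq> 0"
  shows "br (b / y) * br (c * x) * br (q / (x * y)) * br (q * y / x) * br (q * x * y)
   - br (b / y) * br (c / x) * br (q * x / y) * br (q * y / x) * br (q * x * y)
   + br (b * y) * br (c / x) * br (q * x / y) * br (q / (x * y)) * br (q * x * y)
   - br (b * y) * br (c * x) * br (q * x / y) * br (q / (x * y)) * br (q * y / x)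
   = - br (x\<^sup>2) * br (y\<^sup>2) * (br q * (br (b / q) * br (c / q) + br b * br c)
      + br (c / (b * q)) * (br x)\<^sup>2 + br (b / (c * q)) * (br y)\<^sup>2)"
proof -
  have id: "(b * y' - b' * y) * (c * x - c' * x') * (q * x' * y' - q' * x * y)
        * (q * y * x' - q' * y' * x) * (q * x * y - q' * x' * y')
      - (b * y' - b' * y) * (c * x' - c' * x) * (q * x * y' - q' * x' * y)
        * (q * y * x' - q' * y' * x) * (q * x * y - q' * x' * y')
      + (b * y - b' * y') * (c * x' - c' * x) * (q * x * y' - q' * x' * y)
        * (q * x' * y' - q' * x * y) * (q * x * y - q' * x' * y')
      - (b * y - b' * y') * (c * x - c' * x') * (q * x * y' - q' * x' * y)
        * (q * x' * y' - q' * x * y) * (q * y * x' - q' * y' * x)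
      = - (x * x - x' * x') * (y * y - y' * y') *
        ((q - q') * ((b * q' - b' * q) * (c * q' - c' * q) + (b - b') * (c - c'))
        + (c * b' * q' - c' * b * q) * (x - x') * (x - x')
        + (b * c' * q' - b' * c * q) * (y - y') * (y - y'))"
    if i: "q * q' = 1" "x * x' = 1" "y * y' = 1" "b * b' = 1" "c * c' = 1"
    for q' x' y' b' c' :: complex
  proof -
    have j: "q * (q' * w) = w" "x * (x' * w) = w" "y * (y' * w) = w" for w
      using i by (metis mult.assoc mult_1)+
    show ?thesis
      by (simp only: ring_distribs minus_mult_left[symmetric] minus_mult_right[symmetric]
          mult_ac i j minus_minus mult_1_left mult_1_right) simp
  qed
  show ?thesis
    using id[of "inverse q" "inverse x" "inverse y" "inverse b" "inverse c"] assms
    by (simp add: br_def divide_inverse power2_eq_square mult_ac)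
qed

lemma br_mult_diff:
  fixes w z :: complex
  assumes "w \<noteq> 0" "z \<noteq> 0"
  shows "br (w / z) * br (w * z) = (br w)\<^sup>2 - (br z)\<^sup>2"
  using assms by (simp add: br_def field_simps power2_eq_square)

lemma br_inverse: "br (1 / z) = - br z"
  by (simp add: br_def divide_inverse)

lemma br_square: "br (q\<^sup>2) = br q * (q + inverse q)"
  by (simp add: br_def power2_eq_square algebra_simps)

text \<open>In the basis \<open>1 - u - v\<close>, \<open>u\<close>, \<open>v\<close> the
  coefficient of \<open>v\<close> is the constant term plus the ordinary coefficient of
  \<open>v\<close>; exchanging \<open>b\<close> and \<open>c\<close> gives that of
  \<open>u\<close>.\<close>

lemma br_numer_coeff:
  fixes q b c :: complex
  assumes "q \<noteq> 0" "b \<noteq> 0" "c \<noteq> 0"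
  shows "(q + inverse q) * br b * br (c / q) - (br (b / q) * br (c / q) + br b * br c)
    = br q * br (c / (b * q))"
  using assms by (simp add: br_def field_simps power2_eq_square)

text \<open>The evaluation point \<open>1\<close> corresponds to \<open>node q x i = 0\<close>.\<close>

definition node :: "complex \<Rightarrow> (nat \<Rightarrow> complex) \<Rightarrow> nat \<Rightarrow> complex" where
  "node q x i = (br (x i) / br q)\<^sup>2"

lemma br_prod_denom:
  assumes "q \<noteq> 0" "br q \<noteq> 0" "x j \<noteq> 0" "y i \<noteq> 0"
  shows "br (q * x j / y i) * br (q * y i / x j) * br (q * x j * y i) * br (q / (x j * y i)) =
    br q ^ 4 * denom ((q + inverse q)\<^sup>2) (node q y i) (node q x j)"
  unfolding br_prod_eq[OF assms(1,3,4)] using assms(2)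
  by (simp add: denom_def node_def field_simps eval_nat_numeral)

lemma Z_UU2_entry_eq:
  assumes q: "q \<noteq> 0" "br q \<noteq> 0" and b: "b \<noteq> 0" "c \<noteq> 0" and xy: "x j \<noteq> 0" "y i \<noteq> 0"
    and nz: "br (q * x j / y i) \<noteq> 0" "br (q / (x j * y i)) \<noteq> 0"
      "br (q * y i / x j) \<noteq> 0" "br (q * x j * y i) \<noteq> 0"
  defines "\<alpha> \<equiv> br (b / q) * br (c / q) + br b * br c"
    and "\<tau> \<equiv> q + inverse q"
  shows "Z_UU2_entry q b c (x j) (y i) = - br ((y i)\<^sup>2) / br q ^ 3 * br ((x j)\<^sup>2) *
    (numer \<alpha> (\<tau> * br c * br (b / q)) (\<tau> * br b * br (c / q)) (node q y i) (node q x j)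
     / denom (\<tau>\<^sup>2) (node q y i) (node q x j))"
proof -
  let ?p1 = "br (q * x j / y i)" and ?p2 = "br (q / (x j * y i))"
    and ?p3 = "br (q * y i / x j)" and ?p4 = "br (q * x j * y i)"
  let ?N = "numer \<alpha> (\<tau> * br c * br (b / q)) (\<tau> * br b * br (c / q)) (node q y i) (node q x j)"
  let ?D = "denom (\<tau>\<^sup>2) (node q y i) (node q x j)"
  have D: "?p1 * ?p3 * ?p4 * ?p2 = br q ^ 4 * ?D"
    unfolding \<tau>_def using q xy by (rule br_prod_denom)
  have D0: "?D \<noteq> 0" using D nz by auto
  have 1: "\<tau> * br b * br (c / q) = \<alpha> + br q * br (c / (b * q))"
    using br_numer_coeff[OF q(1) b] by (simp add: \<alpha>_def \<tau>_def algebra_simps)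
  have 2: "\<tau> * br c * br (b / q) = \<alpha> + br q * br (b / (c * q))"
    using br_numer_coeff[OF q(1) b(2,1)] by (simp add: \<alpha>_def \<tau>_def algebra_simps)
  have N: "br q * ?N = br q * \<alpha> + br (c / (b * q)) * (br (x j))\<^sup>2 + br (b / (c * q)) * (br (y i))\<^sup>2"
    unfolding numer_def 1 2 using q(2)
    by (simp add: node_def power_divide field_simps power2_eq_square)
  have "Z_UU2_entry q b c (x j) (y i) * (?p1 * ?p3 * ?p4 * ?p2) =
      - br ((x j)\<^sup>2) * br ((y i)\<^sup>2) * (br q * ?N)"
    unfolding N unfolding \<alpha>_def numerator_identity[OF q(1) xy b, symmetric] Z_UU2_entry_def
    using nz by (simp add: ring_distribs)
  then have "Z_UU2_entry q b c (x j) (y i) =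
      - br ((x j)\<^sup>2) * br ((y i)\<^sup>2) * (br q * ?N) / (br q ^ 4 * ?D)"
    unfolding D using q D0 by (subst nonzero_eq_divide_eq) auto
  also have "br q ^ 4 = br q * br q ^ 3"
    by (simp add: eval_nat_numeral)
  finally show ?thesis
    using q(2) by (simp add: mult_ac)
qed

text \<open>The transposition makes \<open>y\<close> the row variable, matching the roles of \<open>y, z\<close> in the final formula.\<close>

lemma det_Z_UU2_entry:
  assumes q: "q \<noteq> 0" "br q \<noteq> 0" and b: "b \<noteq> 0" "c \<noteq> 0" and dom: "(x, y) \<in> Z_UU2_dom n q"
  defines "\<alpha> \<equiv> br (b / q) * br (c / q) + br b * br c"
    and "\<tau> \<equiv> q + inverse q"
  shows "Determinant.det (Matrix.mat n n (\<lambda>(i, j). Z_UU2_entry q b c (x i) (y j))) =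
    (\<Prod>i<n. - br ((y i)\<^sup>2) / br q ^ 3) * (\<Prod>i<n. br ((x i)\<^sup>2))
    * (\<Prod>i<n. \<Prod>m<i. (node q y i - node q y m) * (node q x i - node q x m))
    * Determinant.det (Matrix.mat n n (\<lambda>(i, j). newton_coeff (\<tau>\<^sup>2)
        (numer_array \<alpha> (\<tau> * br c * br (b / q)) (\<tau> * br b * br (c / q)) (node q y) (node q x))
        (node q y) (node q x) i j))"
proof -
  let ?g = "newton_coeff (\<tau>\<^sup>2)
    (numer_array \<alpha> (\<tau> * br c * br (b / q)) (\<tau> * br b * br (c / q)) (node q y) (node q x))
    (node q y) (node q x)"
  have nz: "x j \<noteq> 0" "y i \<noteq> 0" "br (q * x j / y i) \<noteq> 0" "br (q / (x j * y i)) \<noteq> 0"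
      "br (q * y i / x j) \<noteq> 0" "br (q * x j * y i) \<noteq> 0" if "i < n" "j < n" for i j
    using dom that unfolding Z_UU2_dom_def by auto
  have D0: "denom (\<tau>\<^sup>2) (node q y i) (node q x j) \<noteq> 0" if "i < n" "j < n" for i j
    using br_prod_denom[of q x j y i, OF q nz(1,2)[OF that]] nz[OF that] unfolding \<tau>_def by auto
  have "Matrix.mat n n (\<lambda>(i, j). Z_UU2_entry q b c (x i) (y j)) =
      transpose_mat (Matrix.mat n n (\<lambda>(i, j). Z_UU2_entry q b c (x j) (y i)))"
    by (intro eq_matI) auto
  then have "Determinant.det (Matrix.mat n n (\<lambda>(i, j). Z_UU2_entry q b c (x i) (y j))) =
      Determinant.det (Matrix.mat n n (\<lambda>(i, j). Z_UU2_entry q b c (x j) (y i)))"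
    by (simp add: det_transpose[of _ n])
  also have "Matrix.mat n n (\<lambda>(i, j). Z_UU2_entry q b c (x j) (y i)) =
      Matrix.mat n n (\<lambda>(i, j). (- br ((y i)\<^sup>2) / br q ^ 3) * br ((x j)\<^sup>2)
        * newton_eval (node q y) (node q x) ?g i j)"
  proof (intro cong_mat refl, clarify)
    fix i j assume ij: "i < n" "j < n"
    show "Z_UU2_entry q b c (x j) (y i) = (- br ((y i)\<^sup>2) / br q ^ 3) * br ((x j)\<^sup>2)
        * newton_eval (node q y) (node q x) ?g i j"
      unfolding \<tau>_def \<alpha>_def
      using ij D0 Z_UU2_entry_eq[of q b c x j y i, OF q b nz[OF ij]]
      by (subst newton_eval_newton_coeff) (auto simp: \<tau>_def)
  qed
  finally show ?thesis
    unfolding det_newton_eval .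
qed

section \<open>Cancellation of the denominator of the partition function\<close>

lemma prod_lower_triangle_le:
  fixes f :: "nat \<Rightarrow> nat \<Rightarrow> 'a::comm_monoid_mult"
  shows "(\<Prod>j<n. \<Prod>i\<le>j. f i j) = (\<Prod>j<n. \<Prod>i<j. f i j) * (\<Prod>j<n. f j j)"
  by (simp add: lessThan_Suc_atMost[symmetric] prod.distrib)

lemma prod_lower_triangle_const:
  "(\<Prod>j<n. \<Prod>i<j. w :: 'a::comm_monoid_mult) = w ^ (n choose 2)"
proof -
  have "(\<Sum>j<n. j) = n choose 2"
    by (induction n) (simp_all add: numeral_2_eq_2)
  then show ?thesis
    by (simp add: power_sum[symmetric])
qed

text \<open>Pairing \<open>[x_j / x_i]\<close> with \<open>[1 / (x_i x_j)]\<close>, and likewise for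
  \<open>y\<close>, gives differences of squares, that is, of nodes. The diagonal factors match the
  row and column factors of the entries.\<close>

lemma Z_UU2_denom_eq:
  assumes q: "br q \<noteq> 0" and nz: "\<And>i. i < n \<Longrightarrow> x i \<noteq> 0" "\<And>i. i < n \<Longrightarrow> y i \<noteq> 0"
  shows "Z_UU2_denom n x y = (br q ^ 4) ^ (n choose 2)
    * (\<Prod>j<n. \<Prod>i<j. (node q y j - node q y i) * (node q x j - node q x i))
    * (\<Prod>j<n. - (br ((x j)\<^sup>2) * br ((y j)\<^sup>2)))"
proof -
  have "Z_UU2_denom n x y =
      (\<Prod>j<n. \<Prod>i<j. br (x j / x i) * br (y i / y j) * (br (1 / (x i * x j)) * br (y i * y j)))
      * (\<Prod>j<n. br (1 / (x j * x j)) * br (y j * y j))"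
    unfolding Z_UU2_denom_def prod_lower_triangle_le by (simp add: prod.distrib mult_ac)
  also have "(\<Prod>j<n. br (1 / (x j * x j)) * br (y j * y j)) =
      (\<Prod>j<n. - (br ((x j)\<^sup>2) * br ((y j)\<^sup>2)))"
    by (simp add: br_inverse power2_eq_square)
  also have "(\<Prod>j<n. \<Prod>i<j. br (x j / x i) * br (y i / y j) * (br (1 / (x i * x j)) * br (y i * y j)))
      = (\<Prod>j<n. \<Prod>i<j. br q ^ 4 * ((node q y j - node q y i) * (node q x j - node q x i)))"
  proof (intro prod.cong refl)
    fix j i assume "j \<in> {..<n}" "i \<in> {..<j}"
    then have [simp]: "x i \<noteq> 0" "y i \<noteq> 0" "x j \<noteq> 0" "y j \<noteq> 0"
      using nz by auto
    have "br (x j / x i) * br (y i / y j) * (br (1 / (x i * x j)) * br (y i * y j)) =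
        - (br (x j / x i) * br (x j * x i)) * (br (y i / y j) * br (y i * y j))"
      by (simp add: br_inverse mult_ac)
    also have "\<dots> = ((br (x j))\<^sup>2 - (br (x i))\<^sup>2) * ((br (y j))\<^sup>2 - (br (y i))\<^sup>2)"
      by (subst (1 2) br_mult_diff) (simp_all add: algebra_simps)
    also have "\<dots> = br q ^ 4 * ((node q y j - node q y i) * (node q x j - node q x i))"
      using q by (simp add: node_def power_divide field_simps eval_nat_numeral)
    finally show "br (x j / x i) * br (y i / y j) * (br (1 / (x i * x j)) * br (y i * y j)) = \<dots>" .
  qed
  also have "\<dots> = (br q ^ 4) ^ (n choose 2)
      * (\<Prod>j<n. \<Prod>i<j. (node q y j - node q y i) * (node q x j - node q x i))"
    by (simp only: prod.distrib prod_lower_triangle_const)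
  finally show ?thesis .
qed

text \<open>The singular factors \<open>V\<close> and \<open>W\<close> have cancelled, so the right
  side makes sense and is continuous where all \<open>x_i\<close> and \<open>y_j\<close> equal
  1.\<close>

lemma Z_UU2_eq:
  assumes q: "q \<noteq> 0" "br q \<noteq> 0" and b: "b \<noteq> 0" "c \<noteq> 0" and dom: "(x, y) \<in> Z_UU2_dom n q"
  defines "\<alpha> \<equiv> br (b / q) * br (c / q) + br b * br c"
    and "\<tau> \<equiv> q + inverse q"
  shows "Z_UU2 n q b c x y =
    (\<Prod>i<n. \<Prod>j<n. br q ^ 4 * denom (\<tau>\<^sup>2) (node q y j) (node q x i))
    / ((br q ^ 4) ^ (n choose 2) * br q ^ (3 * n))
    * Determinant.det (Matrix.mat n n (\<lambda>(i, j). newton_coeff (\<tau>\<^sup>2)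
        (numer_array \<alpha> (\<tau> * br c * br (b / q)) (\<tau> * br b * br (c / q)) (node q y) (node q x))
        (node q y) (node q x) i j))"
proof -
  have nz: "x i \<noteq> 0" "y i \<noteq> 0" if "i < n" for i
    using dom that unfolding Z_UU2_dom_def by auto
  define V where "V = (\<Prod>j<n. \<Prod>i<j. (node q y j - node q y i) * (node q x j - node q x i))"
  define W where "W = (\<Prod>j<n. - (br ((x j)\<^sup>2) * br ((y j)\<^sup>2)))"
  have denom: "Z_UU2_denom n x y = (br q ^ 4) ^ (n choose 2) * V * W"
    unfolding V_def W_def using q(2) nz by (rule Z_UU2_denom_eq)
  then have VW: "V \<noteq> 0" "W \<noteq> 0"
    using dom unfolding Z_UU2_dom_def by auto
  have W: "(\<Prod>i<n. - br ((y i)\<^sup>2) / br q ^ 3) * (\<Prod>i<n. br ((x i)\<^sup>2)) = W / br q ^ (3 * n)"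
  proof -
    have "(\<Prod>i<n. - br ((y i)\<^sup>2) / br q ^ 3) * (\<Prod>i<n. br ((x i)\<^sup>2)) =
        (\<Prod>i<n. - (br ((x i)\<^sup>2) * br ((y i)\<^sup>2)) / br q ^ 3)"
      unfolding prod.distrib[symmetric] by (intro prod.cong) auto
    then show ?thesis
      unfolding prod_dividef W_def by (simp add: power_mult)
  qed
  have P: "(\<Prod>i<n. \<Prod>j<n. br (q * x i / y j) * br (q * y j / x i)
      * br (q * x i * y j) * br (q / (x i * y j))) =
    (\<Prod>i<n. \<Prod>j<n. br q ^ 4 * denom (\<tau>\<^sup>2) (node q y j) (node q x i))"
    unfolding \<tau>_def using q nz
    by (intro prod.cong refl br_prod_denom[where x = x and y = y]) auto
  show ?thesis
    unfolding Z_UU2_def P det_Z_UU2_entry[OF q b dom] W denom V_def[symmetric] \<alpha>_def \<tau>_def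
    using VW q(2) by (simp add: field_simps)
qed

subsection \<open>The homogeneous limit\<close>

lemma tendsto_det_mat:
  fixes f :: "'b \<Rightarrow> nat \<Rightarrow> nat \<Rightarrow> 'a::{real_normed_field}"
  assumes "\<And>i j. i < n \<Longrightarrow> j < n \<Longrightarrow> ((\<lambda>p. f p i j) \<longlongrightarrow> l i j) F"
  shows "((\<lambda>p. Determinant.det (Matrix.mat n n (\<lambda>(i, j). f p i j)))
    \<longlongrightarrow> Determinant.det (Matrix.mat n n (\<lambda>(i, j). l i j))) F"
proof -
  have *: "Determinant.det (Matrix.mat n n (\<lambda>(i, j). h i j)) =
      (\<Sum>\<pi> | \<pi> permutes {0..<n}. signof \<pi> * (\<Prod>i=0..<n. h i (\<pi> i)))" for h :: "nat \<Rightarrow> nat \<Rightarrow> 'a"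
    by (subst det_def'[of _ n]) (auto intro!: sum.cong prod.cong simp: permutes_in_image)
  have "\<pi> i < n" if "\<pi> permutes {0..<n}" "i < n" for \<pi> i
    using permutes_in_image[OF that(1), of i] that(2) by simp
  then show ?thesis
    unfolding * by (intro tendsto_sum tendsto_mult tendsto_prod tendsto_const assms) auto
qed

lemma tendsto_coordinate:
  fixes a :: "('i \<Rightarrow> 'a::topological_space) \<times> ('j \<Rightarrow> 'b::topological_space)"
  shows "((\<lambda>p. fst p i) \<longlongrightarrow> fst a i) (at a within S)"
    and "((\<lambda>p. snd p j) \<longlongrightarrow> snd a j) (at a within S)"
proof -
  have "continuous_on UNIV (\<lambda>p::('i \<Rightarrow> 'a) \<times> ('j \<Rightarrow> 'b). fst p i)"
    by (rule continuous_on_product_then_coordinatewise[OF continuous_on_fst[OF continuous_on_id]])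
  then show "((\<lambda>p. fst p i) \<longlongrightarrow> fst a i) (at a within S)"
    by (cases a) (auto simp: continuous_on_def intro: tendsto_within_subset)
  have "continuous_on UNIV (\<lambda>p::('i \<Rightarrow> 'a) \<times> ('j \<Rightarrow> 'b). snd p j)"
    by (rule continuous_on_product_then_coordinatewise[OF continuous_on_snd[OF continuous_on_id]])
  then show "((\<lambda>p. snd p j) \<longlongrightarrow> snd a j) (at a within S)"
    by (cases a) (auto simp: continuous_on_def intro: tendsto_within_subset)
qed

lemma tendsto_node:
  assumes "((\<lambda>p. x p i) \<longlongrightarrow> 1) F" "br q \<noteq> 0"
  shows "((\<lambda>p. node q (x p) i) \<longlongrightarrow> 0) F"
proof -
  have "((\<lambda>p. node q (x p) i) \<longlongrightarrow> ((1 - inverse 1) / br q)\<^sup>2) F"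
    unfolding node_def br_def[of "x _ i"] using assms by (intro tendsto_intros) auto
  then show ?thesis by simp
qed

lemma tendsto_numer_array:
  fixes u v :: "'b \<Rightarrow> nat \<Rightarrow> 'a::real_normed_field"
  assumes "((\<lambda>p. u p i) \<longlongrightarrow> u0 i) F" "((\<lambda>p. v p j) \<longlongrightarrow> v0 j) F"
  shows "((\<lambda>p. numer_array A B C (u p) (v p) i j) \<longlongrightarrow> numer_array A B C u0 v0 i j) F"
  unfolding numer_array_def shift_compl_def shift_fst_def shift_snd_def
  using assms by (intro tendsto_intros) auto

lemma Z_UU2_limit_trinomial:
  assumes q: "q \<noteq> 0" "br q \<noteq> 0" and b: "b \<noteq> 0" "c \<noteq> 0"
  defines "\<alpha> \<equiv> br (b / q) * br (c / q) + br b * br c"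
    and "\<tau> \<equiv> q + inverse q"
  shows "Z_UU2_limit n q b c
    (br q ^ (4 * n * n) / ((br q ^ 4) ^ (n choose 2) * br q ^ (3 * n))
    * Determinant.det (Matrix.mat n n (\<lambda>(i, j).
        trinomial_comb (n - 1) \<alpha> (\<tau> * br c * br (b / q)) (\<tau> * br b * br (c / q)) (\<tau>\<^sup>2) i j)))"
proof -
  let ?F = "at (\<lambda>_::nat. 1::complex, \<lambda>_::nat. 1::complex) within Z_UU2_dom n q"
  let ?B = "\<tau> * br c * br (b / q)" and ?C = "\<tau> * br b * br (c / q)"
  define u where "u p = node q (snd p)" for p :: "(nat \<Rightarrow> complex) \<times> (nat \<Rightarrow> complex)"
  define v where "v p = node q (fst p)" for p :: "(nat \<Rightarrow> complex) \<times> (nat \<Rightarrow> complex)"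
  let ?g = "\<lambda>u v. newton_coeff (\<tau>\<^sup>2) (numer_array \<alpha> ?B ?C u v) u v"
  have u: "((\<lambda>p. u p i) \<longlongrightarrow> 0) ?F" and v: "((\<lambda>p. v p i) \<longlongrightarrow> 0) ?F" for i
    unfolding u_def v_def
    using tendsto_coordinate[of i "(\<lambda>_::nat. 1::complex, \<lambda>_::nat. 1::complex)"] q(2)
    by (auto intro!: tendsto_node)
  have D0: "denom (\<tau>\<^sup>2) 0 0 = 1" by (simp add: denom_def)
  have D: "((\<lambda>p. denom (\<tau>\<^sup>2) (u p j) (v p i)) \<longlongrightarrow> denom (\<tau>\<^sup>2) 0 0) ?F" for i j
    unfolding denom_def by (intro tendsto_intros u v)
  have g: "((\<lambda>p. ?g (u p) (v p) i j) \<longlongrightarrow> trinomial_comb (n - 1) \<alpha> ?B ?C (\<tau>\<^sup>2) i j) ?F"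
    if "i < n" "j < n" for i j
  proof -
    have "((\<lambda>p. ?g (u p) (v p) i j) \<longlongrightarrow> ?g zero_seq zero_seq i j) ?F"
      using u v that by (intro tendsto_newton_coeff[of n] tendsto_numer_array) (auto simp: D0)
    \<comment> \<open>With all nodes zero the recursion computes Taylor coefficients;
      \<open>n - 1\<close> is the largest index, so the sums cut there are complete.\<close>
    also have "?g zero_seq zero_seq i j = trinomial_comb (n - 1) \<alpha> ?B ?C (\<tau>\<^sup>2) i j"
      using that by (intro newton_coeff_unique[of n] denom_shift_trinomial_comb) (auto simp: D0)
    finally show ?thesis .
  qed
  have "((\<lambda>p. (\<Prod>i<n. \<Prod>j<n. br q ^ 4 * denom (\<tau>\<^sup>2) (u p j) (v p i))
      / ((br q ^ 4) ^ (n choose 2) * br q ^ (3 * n))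
      * Determinant.det (Matrix.mat n n (\<lambda>(i, j). ?g (u p) (v p) i j))) \<longlongrightarrow>
    (\<Prod>i<n. \<Prod>j<n. br q ^ 4 * denom (\<tau>\<^sup>2) 0 0)
      / ((br q ^ 4) ^ (n choose 2) * br q ^ (3 * n))
      * Determinant.det (Matrix.mat n n (\<lambda>(i, j). trinomial_comb (n - 1) \<alpha> ?B ?C (\<tau>\<^sup>2) i j))) ?F"
    using q(2) by (intro tendsto_intros tendsto_det_mat D g) auto
  also have "(\<Prod>i<n. \<Prod>j<n. br q ^ 4 * denom (\<tau>\<^sup>2) 0 0) = br q ^ (4 * n * n)"
    by (simp add: D0 power_mult)
  finally show ?thesis
    \<comment> \<open>The closed form is known to equal \<open>Z_UU2\<close> on the domain, to which
      the filter is restricted.\<close>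
    unfolding Z_UU2_limit_def
    by (rule Lim_transform_eventually)
      (auto simp: eventually_at_filter Z_UU2_eq[OF q b] u_def v_def \<alpha>_def \<tau>_def
        intro!: always_eventually)
qed

section \<open>Approach to the limit point within the domain\<close>

lemma br_eq_0_iff: "z \<noteq> 0 \<Longrightarrow> br z = 0 \<longleftrightarrow> z\<^sup>2 = 1"
  by (simp add: br_def power2_eq_square nonzero_eq_divide_eq[symmetric] divide_inverse)

text \<open>Without this, every number would be a limit and the polynomial would not be unique.\<close>

lemma Z_UU2_dom_nontrivial:
  assumes q: "q \<noteq> 0" "br q \<noteq> 0"
  shows "at (\<lambda>_. 1, \<lambda>_. 1) within Z_UU2_dom n q \<noteq> bot"
proof -
  \<comment> \<open>For \<open>e > 0\<close> these are distinct reals above 1, so no ratio of two of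
    them and no product is 1 or -1. The same tuple can serve for \<open>x\<close> and
    \<open>y\<close>, as \<open>Z_UU2_denom\<close> never compares an \<open>x\<close> with a
    \<open>y\<close>.\<close>
  define w where "w e i = (1 + of_real ((real i + 1) * e) :: complex)" for e :: real and i :: nat
  define path where "path e = (w e, w e)" for e
  let ?F = "at_right (0::real)"
  have w: "((\<lambda>e. w e i) \<longlongrightarrow> 1) ?F" for i
    unfolding w_def by (auto intro!: tendsto_eq_intros)
  have "continuous_on UNIV w"
    unfolding w_def by (intro continuous_on_coordinatewise_then_product continuous_intros)
  then have "continuous_on UNIV path"
    unfolding path_def by (intro continuous_on_Pair)
  then have "(path \<longlongrightarrow> path 0) ?F"
    unfolding continuous_on_def by (auto intro: tendsto_within_subset)
  moreover have "path 0 = (\<lambda>_. 1, \<lambda>_. 1)"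
    by (simp add: path_def w_def fun_eq_iff)
  ultimately have lim: "(path \<longlongrightarrow> (\<lambda>_. 1, \<lambda>_. 1)) ?F" by simp
  have pos: "\<forall>\<^sub>F e in ?F. e > 0"
    by (simp add: eventually_at_right_less)
  have br_real: "br (of_real r) \<noteq> 0" if "r > 0" "r \<noteq> 1" for r :: real
  proof -
    have "r\<^sup>2 \<noteq> 1" using that by (simp add: power2_eq_1_iff)
    then show ?thesis
      using that by (subst br_eq_0_iff) (auto simp flip: of_real_power)
  qed
  have *: "br (w e j / w e i) \<noteq> 0" "br (1 / (w e i * w e k)) \<noteq> 0" "br (w e i * w e k) \<noteq> 0"
      "w e i \<noteq> 0" if "e > 0" "i \<noteq> j" for e i j k
  proof -
    define r where "r i = 1 + (real i + 1) * e" for i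
    have wr: "w e i = of_real (r i)" for i
      by (simp add: w_def r_def)
    have r: "r i > 1" for i
      using that by (simp add: r_def add_pos_pos)
    have "r j \<noteq> r i" using that by (simp add: r_def)
    moreover have "r i * r k > 1" using r[of i] r[of k] by (simp add: less_1_mult)
    ultimately show "br (w e j / w e i) \<noteq> 0" "br (1 / (w e i * w e k)) \<noteq> 0"
      "br (w e i * w e k) \<noteq> 0" "w e i \<noteq> 0"
      using r[of i] r[of j] r[of k] br_real[of "r j / r i"] br_real[of "1 / (r i * r k)"]
        br_real[of "r i * r k"]
      by (auto simp: wr)
  qed
  have dom_denom: "Z_UU2_denom n (w e) (w e) \<noteq> 0" if "e > 0" for e
  proof -
    have "br (1 / (w e i * w e k)) \<noteq> 0" "br (w e i * w e k) \<noteq> 0" for i k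
      using *(2,3)[OF that n_not_Suc_n] by auto
    then show ?thesis
      unfolding Z_UU2_denom_def using *(1)[OF that] by auto
  qed
  \<comment> \<open>The remaining denominators tend to \<open>[q]\<close>, which is nonzero.\<close>
  have ev: "\<forall>\<^sub>F e in ?F. br (f e) \<noteq> 0" if "(f \<longlongrightarrow> q) ?F" for f
  proof -
    have "((\<lambda>e. br (f e)) \<longlongrightarrow> br q) ?F"
      unfolding br_def using that q(1) by (intro tendsto_intros)
    then show ?thesis using q(2) by (rule tendsto_imp_eventually_ne)
  qed
  have "\<forall>\<^sub>F e in ?F. \<forall>i\<in>{..<n}. \<forall>j\<in>{..<n}. br (q * w e i / w e j) \<noteq> 0 \<and> br (q / (w e i * w e j)) \<noteq> 0 \<and>
      br (q * w e j / w e i) \<noteq> 0 \<and> br (q * w e i * w e j) \<noteq> 0"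
    by (intro eventually_ball_finite finite_lessThan ballI eventually_conj ev)
      (auto intro!: tendsto_eq_intros w)
  with pos have "\<forall>\<^sub>F e in ?F. path e \<in> Z_UU2_dom n q \<and> path e \<noteq> (\<lambda>_. 1, \<lambda>_. 1)"
  proof eventually_elim
    case (elim e)
    have "w e 0 \<noteq> 1" using elim by (simp add: w_def)
    then have "path e \<noteq> (\<lambda>_. 1, \<lambda>_. 1)" by (auto simp: path_def fun_eq_iff)
    then show ?case
      using elim dom_denom *(4)[OF _ n_not_Suc_n] by (auto simp: path_def Z_UU2_dom_def)
  qed
  with lim have "filterlim path (at (\<lambda>_. 1, \<lambda>_. 1) within Z_UU2_dom n q) ?F"
    by (simp add: filterlim_at)
  then show ?thesis
    by (auto simp: filterlim_def bot_unique filtermap_bot_iff trivial_limit_at_right_real)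
qed

subsection \<open>The polynomial identity\<close>

lemma comm_ring_hom_eval3: "comm_ring_hom (\<lambda>P. eval3 P t y z)"
  by unfold_locales (simp_all add: eval3_def)

lemma eval3_simps [simp]:
  "eval3 (P + Q) t y z = eval3 P t y z + eval3 Q t y z"
  "eval3 (P - Q) t y z = eval3 P t y z - eval3 Q t y z"
  "eval3 (P * Q) t y z = eval3 P t y z * eval3 Q t y z"
  "eval3 (P ^ k) t y z = eval3 P t y z ^ k"
  "eval3 1 t y z = 1"
  "eval3 (of_nat k) t y z = of_nat k"
  "eval3 t_var t y z = t"
  "eval3 y_var t y z = y"
  "eval3 z_var t y z = z"
  by (simp_all add: eval3_def t_var_def y_var_def z_var_def of_nat_poly)

lemma eval3_sum: "eval3 (\<Sum>k\<in>A. f k) t y z = (\<Sum>k\<in>A. eval3 (f k) t y z)"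
  by (simp add: eval3_def poly_sum)

lemma eval3_det:
  "eval3 (Determinant.det (Matrix.mat n n (\<lambda>(i, j). f i j))) t y z =
    Determinant.det (Matrix.mat n n (\<lambda>(i, j). eval3 (f i j) t y z))"
proof -
  interpret comm_ring_hom "\<lambda>P. eval3 P t y z"
    by (rule comm_ring_hom_eval3)
  have "map_mat (\<lambda>P. eval3 P t y z) (Matrix.mat n n (\<lambda>(i, j). f i j)) =
      Matrix.mat n n (\<lambda>(i, j). eval3 (f i j) t y z)"
    by (intro eq_matI) auto
  then show ?thesis
    by (metis hom_det)
qed

section \<open>Uniqueness of the polynomial\<close>

lemma poly_eq_0_of_infinite_zeros:
  fixes p :: "'a::idom poly"
  assumes "infinite S" "\<And>x. x \<in> S \<Longrightarrow> poly p x = 0"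
  shows "p = 0"
proof (rule ccontr)
  assume "p \<noteq> 0"
  then have "finite {x. poly p x = 0}" by (rule poly_roots_finite)
  moreover have "S \<subseteq> {x. poly p x = 0}" using assms(2) by auto
  ultimately show False using assms(1) finite_subset by blast
qed

lemma poly_poly_const:
  fixes p :: "'a::comm_ring_1 poly poly"
  shows "poly (poly p [:y:]) t = poly (map_poly (\<lambda>c. poly c t) p) y"
  by (induction p) (simp_all add: map_poly_pCons)

text \<open>For fixed \<open>t\<close>, infinitely many \<open>y\<close> annihilate every
  coefficient at \<open>t\<close>; infinitely many \<open>t\<close> then annihilate the coefficients
  themselves. The set of \<open>y\<close> may vary with \<open>t\<close>.\<close>

lemma poly_poly_eq_0_of_infinite_zeros:
  fixes p :: "'a::idom poly poly"
  assumes "infinite S" "\<And>t. t \<in> S \<Longrightarrow> infinite (Y t)"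
    and "\<And>t y. t \<in> S \<Longrightarrow> y \<in> Y t \<Longrightarrow> poly (poly p [:y:]) t = 0"
  shows "p = 0"
proof (rule poly_eqI)
  fix k
  have "poly (coeff p k) t = 0" if "t \<in> S" for t
  proof -
    have "map_poly (\<lambda>c. poly c t) p = 0"
      using assms(2,3)[OF that] by (intro poly_eq_0_of_infinite_zeros) (auto simp: poly_poly_const)
    then have "coeff (map_poly (\<lambda>c. poly c t) p) k = 0" by simp
    then show ?thesis by (simp add: coeff_map_poly)
  qed
  with assms(1) show "coeff p k = coeff 0 k"
    by (simp add: poly_eq_0_of_infinite_zeros)
qed

text \<open>Substituting \<open>y\<close> and \<open>t\<close> in the coefficients first leaves a
  univariate polynomial in \<open>z\<close>.\<close>

lemma eval3_eq_poly:
  "eval3 P t y z = poly (map_poly (\<lambda>c. poly (poly c [:y:]) t) P) z"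
  unfolding eval3_def by (induction P) (simp_all add: map_poly_pCons)

text \<open>One set \<open>Y t\<close> serves for \<open>y\<close> and \<open>z\<close>, matching
  parameters \<open>b\<close> and \<open>c\<close> that range over the same values for a given
  \<open>q\<close>.\<close>

lemma eval3_eq_0_of_infinite_zeros:
  assumes "infinite S" "\<And>t. t \<in> S \<Longrightarrow> infinite (Y t)"
    and "\<And>t y z. t \<in> S \<Longrightarrow> y \<in> Y t \<Longrightarrow> z \<in> Y t \<Longrightarrow> eval3 P t y z = 0"
  shows "P = 0"
proof (rule poly_eqI)
  fix k
  have "poly (poly (coeff P k) [:y:]) t = 0" if "t \<in> S" "y \<in> Y t" for t y
  proof -
    have "map_poly (\<lambda>c. poly (poly c [:y:]) t) P = 0"
      using assms(2)[OF that(1)] assms(3)[OF that]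
      by (intro poly_eq_0_of_infinite_zeros) (auto simp: eval3_eq_poly)
    then have "coeff (map_poly (\<lambda>c. poly (poly c [:y:]) t) P) k = 0" by simp
    then show ?thesis by (simp add: coeff_map_poly)
  qed
  then have "coeff P k = 0"
    using assms(1,2) by (intro poly_poly_eq_0_of_infinite_zeros[where S = S and Y = Y])
  then show "coeff P k = coeff 0 k" by simp
qed

lemma br_of_real_neq_0:
  assumes "r > 1"
  shows "br (of_real r) \<noteq> 0"
  using assms by (subst br_eq_0_iff) (auto simp: power2_eq_1_iff simp flip: of_real_power)

lemma is_A_UU2_unique:
  assumes "is_A_UU2 n P" "is_A_UU2 n Q"
  shows "P = Q"
proof -
  let ?t = "\<lambda>q. (br (q\<^sup>2) / br q)\<^sup>2" and ?y = "\<lambda>q b. br (b * q) / br (b / q)"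
  \<comment> \<open>Real parameters with \<open>b > q > 1\<close> keep \<open>[q]\<close> and
    \<open>[b/q]\<close> nonzero.\<close>
  define q where "q k = complex_of_real (real k + 2)" for k
  define b where "b k l = complex_of_real (real k + real l + 3)" for k l
  have q0: "q k \<noteq> 0" "br (q k) \<noteq> 0" "b k l \<noteq> 0" for k l
    unfolding q_def b_def of_real_eq_0_iff
    using br_of_real_neq_0[of "real k + 2"] by simp_all
  have b0: "br (b k l / q k) \<noteq> 0" for k l
    unfolding q_def b_def of_real_divide[symmetric] by (intro br_of_real_neq_0) simp
  have vanish: "eval3 (P - Q) (?t (q k)) (?y (q k) (b k l)) (?y (q k) (b k m)) = 0" for k l m
  proof -
    obtain L where L: "Z_UU2_limit n (q k) (b k l) (b k m) L"
      "eval3 P (?t (q k)) (?y (q k) (b k l)) (?y (q k) (b k m)) = br ((q k)\<^sup>2) ^ (2 * n) * L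
         / (br (q k) ^ (n * (2 * n + 1)) * (br (b k l / q k) * br (b k m / q k)) ^ n)"
      using assms(1) q0 b0 unfolding is_A_UU2_def by blast
    obtain L' where L': "Z_UU2_limit n (q k) (b k l) (b k m) L'"
      "eval3 Q (?t (q k)) (?y (q k) (b k l)) (?y (q k) (b k m)) = br ((q k)\<^sup>2) ^ (2 * n) * L'
         / (br (q k) ^ (n * (2 * n + 1)) * (br (b k l / q k) * br (b k m / q k)) ^ n)"
      using assms(2) q0 b0 unfolding is_A_UU2_def by blast
    \<comment> \<open>Both polynomials are tied to a limit along the same nontrivial filter.\<close>
    have "L = L'"
      using L(1) L'(1) Z_UU2_dom_nontrivial[OF q0(1,2)] unfolding Z_UU2_limit_def
      by (rule tendsto_unique[rotated])
    then show ?thesis by (simp add: L L')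
  qed
  have inj_t: "inj (\<lambda>k. ?t (q k))"
  proof (rule injI)
    fix k l assume "?t (q k) = ?t (q l)"
    moreover have "?t (q k) = of_real ((real k + 2 + 1 / (real k + 2))\<^sup>2)" for k
    proof -
      have "br ((q k)\<^sup>2) / br (q k) = q k + inverse (q k)"
        using q0(2)[of k] by (simp add: br_square)
      then show ?thesis by (simp add: q_def divide_inverse)
    qed
    ultimately have "(real k + 2 + 1 / (real k + 2))\<^sup>2 = (real l + 2 + 1 / (real l + 2))\<^sup>2"
      by (simp only: of_real_eq_iff)
    then have "real k + 2 + 1 / (real k + 2) = real l + 2 + 1 / (real l + 2)"
      by (simp add: power2_eq_iff_nonneg)
    \<comment> \<open>The map \<open>s -> s + 1/s\<close> is injective for \<open>s > 1\<close>: the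
      difference of two values has the factors \<open>s - s'\<close> and
      \<open>s s' - 1\<close>.\<close>
    then have "(real k - real l) * ((real k + 2) * (real l + 2) - 1) = 0"
      by (simp add: field_simps)
    moreover have "(real k + 2) * (real l + 2) \<ge> 2 * 2"
      by (intro mult_mono) auto
    ultimately show "k = l" by auto
  qed
  have inj_y: "inj (\<lambda>l. ?y (q k) (b k l))" for k
  proof (rule injI)
    fix l m assume eq: "?y (q k) (b k l) = ?y (q k) (b k m)"
    \<comment> \<open>The cross difference of two fractions \<open>[bq]/[b/q]\<close> factors, so
      equal values of \<open>y\<close> force equal squares of \<open>b\<close>.\<close>
    have "br (b k l * q k) * br (b k m / q k) - br (b k m * q k) * br (b k l / q k) = 
      br ((q k)\<^sup>2) * br (b k m / b k l)"
      using q0 by (simp add: br_def field_simps power2_eq_square)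
    moreover have "br (b k l * q k) * br (b k m / q k) - br (b k m * q k) * br (b k l / q k) = 0"
      using eq b0[of k l] b0[of k m] by (simp add: field_simps)
    moreover have "br ((q k)\<^sup>2) \<noteq> 0"
      unfolding q_def of_real_power[symmetric]
      by (intro br_of_real_neq_0) (simp add: power2_eq_square algebra_simps add_pos_nonneg)
    ultimately have "br (b k m / b k l) = 0" by simp
    then have "(b k m / b k l)\<^sup>2 = 1"
      using q0 by (subst (asm) br_eq_0_iff) auto
    then have "(b k m)\<^sup>2 = (b k l)\<^sup>2"
      using q0 by (simp add: power_divide)
    then have "(real k + real m + 3)\<^sup>2 = (real k + real l + 3)\<^sup>2"
      unfolding b_def of_real_power[symmetric] by (simp only: of_real_eq_iff)
    then show "l = m" by (simp add: power2_eq_iff_nonneg)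
  qed
  have "P - Q = 0"
  proof (rule eval3_eq_0_of_infinite_zeros)
    show "infinite (range (\<lambda>k. ?t (q k)))"
      using inj_t by (rule range_inj_infinite)
    \<comment> \<open>The fibre must be a function of \<open>t\<close>, so the index is recovered
      from \<open>t\<close> by injectivity.\<close>
    let ?k = "\<lambda>t. inv_into UNIV (\<lambda>k. ?t (q k)) t"
    let ?Y = "\<lambda>t. range (\<lambda>l. ?y (q (?k t)) (b (?k t) l))"
    show "infinite (?Y t)" for t
      using inj_y by (rule range_inj_infinite)
    show "eval3 (P - Q) t y z = 0"
      if "t \<in> range (\<lambda>k. ?t (q k))" "y \<in> ?Y t" "z \<in> ?Y t" for t y z
    proof -
      obtain k where k: "t = ?t (q k)" using \<open>t \<in> _\<close> by blast
      have "?k t = k" unfolding k using inj_t by (rule inv_f_f)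
      then obtain l m where "y = ?y (q k) (b k l)" "z = ?y (q k) (b k m)"
        using \<open>y \<in> _\<close> \<open>z \<in> _\<close> by auto
      then show ?thesis
        unfolding k by (simp only: vanish)
    qed
  qed
  then show ?thesis by simp
qed

text \<open>Under the substitution, \<open>t + (1+y)(1+z)\<close>, \<open>(1+z)t\<close> and
  \<open>(1+y)t\<close> are one common multiple of the three numerator coefficients; the
  \<open>t\<close> in the last two comes from \<open>t^(k+1)\<close>. The multiple leaves the
  determinant as an \<open>n\<close>-th power.\<close>

lemma is_A_UU2_det:
  "is_A_UU2 n (Determinant.det (Matrix.mat n n (\<lambda>(i, j).
      \<Sum>k = 0..n - 1.
        (t_var + (1 + y_var) * (1 + z_var))
          * of_nat ((i + j) choose (i + k)) * of_nat ((i + k) choose (2 * k)) * t_var ^ k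
      + ((1 + z_var) * of_nat ((i + j) choose (i + k)) * of_nat ((i + k) choose (2 * k + 1))
         + (1 + y_var) * of_nat ((i + j) choose (i + k + 1)) * of_nat ((i + k + 1) choose (2 * k + 1)))
        * t_var ^ (k + 1))))" (is "is_A_UU2 n ?P")
  unfolding is_A_UU2_def
proof (intro allI impI, elim conjE)
  fix q b c :: complex
  assume q: "q \<noteq> 0" "br q \<noteq> 0" and b: "b \<noteq> 0" "c \<noteq> 0"
    and bq: "br (b / q) \<noteq> 0" and cq: "br (c / q) \<noteq> 0"
  let ?\<alpha> = "br (b / q) * br (c / q) + br b * br c" and ?\<tau> = "q + inverse q"
  let ?g = "trinomial_comb (n - 1) ?\<alpha> (?\<tau> * br c * br (b / q)) (?\<tau> * br b * br (c / q)) (?\<tau>\<^sup>2)"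
  let ?t = "(br (q\<^sup>2) / br q)\<^sup>2" and ?y = "br (b * q) / br (b / q)" and ?z = "br (c * q) / br (c / q)"
  define L where "L = br q ^ (4 * n * n) / ((br q ^ 4) ^ (n choose 2) * br q ^ (3 * n))
    * Determinant.det (Matrix.mat n n (\<lambda>(i, j). ?g i j))"
  define \<phi> where "\<phi> = ?\<tau>\<^sup>2 / (br (b / q) * br (c / q))"
  have "Z_UU2_limit n q b c L"
    unfolding L_def using q b by (rule Z_UU2_limit_trinomial)
  moreover have "eval3 ?P ?t ?y ?z = br (q\<^sup>2) ^ (2 * n) * L
      / (br q ^ (n * (2 * n + 1)) * (br (b / q) * br (c / q)) ^ n)"
  proof -
    have t: "?t = ?\<tau>\<^sup>2" using q by (simp add: br_square)
    \<comment> \<open>This addition formula is why \<open>1 + y\<close> and \<open>1 + z\<close>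
      factor.\<close>
    have sum_br: "br (a * q) + br (a / q) = br a * ?\<tau>" if "a \<noteq> 0" for a
      using q that by (simp add: br_def field_simps)
    have y: "1 + ?y = br b * ?\<tau> / br (b / q)" and z: "1 + ?z = br c * ?\<tau> / br (c / q)"
      using sum_br[OF b(1)] sum_br[OF b(2)] bq cq by (simp_all add: field_simps)
    have 1: "?\<tau>\<^sup>2 + (1 + ?y) * (1 + ?z) = \<phi> * ?\<alpha>"
      unfolding y z \<phi>_def using bq cq by (simp add: field_simps power2_eq_square)
    have 2: "(1 + ?z) * ?\<tau>\<^sup>2 = \<phi> * (?\<tau> * br c * br (b / q))"
      unfolding z \<phi>_def using bq cq by (simp add: field_simps power2_eq_square)
    have 3: "(1 + ?y) * ?\<tau>\<^sup>2 = \<phi> * (?\<tau> * br b * br (c / q))"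
      unfolding y \<phi>_def using bq cq by (simp add: field_simps power2_eq_square)
    have "eval3 ?P ?t ?y ?z = Determinant.det (Matrix.mat n n (\<lambda>(i, j). \<phi> * ?g i j))"
      unfolding eval3_det t
    proof (rule arg_cong[where f = Determinant.det], intro cong_mat refl, clarify)
      fix i j
      show "eval3 (\<Sum>k = 0..n - 1.
        (t_var + (1 + y_var) * (1 + z_var))
          * of_nat ((i + j) choose (i + k)) * of_nat ((i + k) choose (2 * k)) * t_var ^ k
      + ((1 + z_var) * of_nat ((i + j) choose (i + k)) * of_nat ((i + k) choose (2 * k + 1))
         + (1 + y_var) * of_nat ((i + j) choose (i + k + 1)) * of_nat ((i + k + 1) choose (2 * k + 1)))
        * t_var ^ (k + 1)) (?\<tau>\<^sup>2) ?y ?z = \<phi> * ?g i j"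
        (is "eval3 (\<Sum>k = 0..n - 1. ?f k) _ _ _ = _")
      proof -
        let ?E = "\<lambda>k. of_nat ((i + j) choose (i + k)) * of_nat ((i + k) choose (2 * k)) * (?\<tau>\<^sup>2) ^ k"
        let ?F = "\<lambda>k. of_nat ((i + j) choose (i + k)) * of_nat ((i + k) choose (2 * k + 1)) * (?\<tau>\<^sup>2) ^ k"
        let ?G = "\<lambda>k. of_nat ((i + j) choose (i + k + 1)) * of_nat ((i + k + 1) choose (2 * k + 1)) * (?\<tau>\<^sup>2) ^ k"
        have "eval3 (?f k) (?\<tau>\<^sup>2) ?y ?z = (?\<tau>\<^sup>2 + (1 + ?y) * (1 + ?z)) * ?E k
            + (1 + ?z) * ?\<tau>\<^sup>2 * ?F k + (1 + ?y) * ?\<tau>\<^sup>2 * ?G k" for k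
          unfolding eval3_simps power_add power_one_right by (simp only: ring_distribs mult_ac add_ac)
        then have "eval3 (?f k) (?\<tau>\<^sup>2) ?y ?z = \<phi> * (?\<alpha> * ?E k
            + ?\<tau> * br c * br (b / q) * ?F k + ?\<tau> * br b * br (c / q) * ?G k)" for k
          unfolding 1 2 3 by (simp only: ring_distribs mult_ac)
        then show ?thesis
          unfolding eval3_sum trinomial_comb_def trinomial_even_def trinomial_fst_def
            trinomial_snd_def atLeast0AtMost
          by (simp only: sum.distrib sum_distrib_left[symmetric])
      qed
    qed
    also have "Matrix.mat n n (\<lambda>(i, j). \<phi> * ?g i j) = \<phi> \<cdot>\<^sub>m Matrix.mat n n (\<lambda>(i, j). ?g i j)"
      by (intro eq_matI) auto
    also have "Determinant.det \<dots> = \<phi> ^ n * Determinant.det (Matrix.mat n n (\<lambda>(i, j). ?g i j))"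
      by simp
    also have "\<dots> = br (q\<^sup>2) ^ (2 * n) * L
      / (br q ^ (n * (2 * n + 1)) * (br (b / q) * br (c / q)) ^ n)"
    proof -
      define M where "M = br q ^ (4 * n * n) / ((br q ^ 4) ^ (n choose 2) * br q ^ (3 * n))"
      \<comment> \<open>Balance of the exponents of \<open>[q]\<close>: those of the limit against
        the normalisation and the \<open>[q]^(2n)\<close> contained in
        \<open>[q^2]^(2n)\<close>.\<close>
      have "2 * (n choose 2) + n = n * n"
        by (induction n) (simp_all add: numeral_2_eq_2)
      then have "4 * (n choose 2) + 3 * n + n * (2 * n + 1) = 2 * n + 4 * n * n"
        by (simp add: algebra_simps)
      then have "(br q ^ 4) ^ (n choose 2) * br q ^ (3 * n) * br q ^ (n * (2 * n + 1)) =
          br q ^ (2 * n) * br q ^ (4 * n * n)"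
        by (simp only: power_mult[symmetric] power_add[symmetric])
      then have M: "br q ^ (2 * n) * M / br q ^ (n * (2 * n + 1)) = 1"
        using q unfolding M_def by (simp add: divide_eq_eq mult_ac)
      have \<phi>: "br (q\<^sup>2) ^ (2 * n) / (br (b / q) * br (c / q)) ^ n = br q ^ (2 * n) * \<phi> ^ n"
        by (simp add: br_square \<phi>_def power_mult_distrib power_divide power_mult)
      let ?d = "Determinant.det (Matrix.mat n n (\<lambda>(i, j). ?g i j))"
      have "br (q\<^sup>2) ^ (2 * n) * L / (br q ^ (n * (2 * n + 1)) * (br (b / q) * br (c / q)) ^ n) =
          br (q\<^sup>2) ^ (2 * n) / (br (b / q) * br (c / q)) ^ n * (M / br q ^ (n * (2 * n + 1))) * ?d"
        unfolding L_def M_def[symmetric] by (simp add: mult_ac)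
      also have "\<dots> = br q ^ (2 * n) * M / br q ^ (n * (2 * n + 1)) * (\<phi> ^ n * ?d)"
        unfolding \<phi> by simp
      finally show ?thesis
        unfolding M by simp
    qed
    finally show ?thesis .
  qed
  ultimately show "\<exists>L. Z_UU2_limit n q b c L \<and> eval3 ?P ?t ?y ?z = br (q\<^sup>2) ^ (2 * n) * L
      / (br q ^ (n * (2 * n + 1)) * (br (b / q) * br (c / q)) ^ n)"
    by blast
qed

theorem proposition5p10:
  fixes n :: nat
  assumes "n \<ge> 1"
  shows "(\<exists>!P. is_A_UU2 n P) \<and>
    A_UU2 n = Determinant.det (Matrix.mat n n (\<lambda>(i, j).
      \<Sum>k = 0..n - 1.
        (t_var + (1 + y_var) * (1 + z_var))
          * of_nat ((i + j) choose (i + k)) * of_nat ((i + k) choose (2 * k)) * t_var ^ k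
      + ((1 + z_var) * of_nat ((i + j) choose (i + k)) * of_nat ((i + k) choose (2 * k + 1))
         + (1 + y_var) * of_nat ((i + j) choose (i + k + 1)) * of_nat ((i + k + 1) choose (2 * k + 1)))
        * t_var ^ (k + 1)))"
proof -
  have "\<exists>!P. is_A_UU2 n P"
    using is_A_UU2_det is_A_UU2_unique by blast
  then show ?thesis
    unfolding A_UU2_def using is_A_UU2_det by (blast intro: the1_equality)
qed

end
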